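(* Let $S:\tilde{\mathfrak H}\to\tilde{\mathfrak H}$ be the linear map $S(U)=P_{\rm sym}UP_{\rm sym}$. Then $S(\tilde{\mathfrak H})=S(\widetilde{AW}(3,Q_0))$. Consequently the spherical subalgebra $S(\tilde{\mathfrak H})$ is isomorphic to the algebra $AW(3,Q_0)$: the map $$U\mapsto (1-ab)^{-1}\,\widetilde U\,(T_1+1),$$ where $U\mapsto\widetilde U$ sends words $U$ in $AW(3,Q_0)$ involving $K_0,K_1$ to the same words $\widetilde U$ in $\widetilde{AW}(3,Q_0)$ (extended linearly), is a well-defined algebra isomorphism from $AW(3,Q_0)$ onto $S(\tilde{\mathfrak H})$.
   Context: All algebras are associative unital algebras over $\mathbb C$. Parameters: $q,a,b,c,d\in\mathbb C$ with $q\ne0$, $q^m\ne1$ for $m=1,2,\ldots$; $a,b,c,d\ne0$; $abcd\ne q^{-m}$ for $m=0,1,2,\ldots$; and $ab\ne1$. Let $e_1=a+b+c+d$, $e_2=ab+ac+bc+ad+bd+cd$, $e_3=abc+abd+acd+bcd$, $e_4=abcd$. Structure constants: $B=(1-q^{-1})^2(e_3+qe_1)$, $C_0=(q-q^{-1})^2$, $C_1=q^{-1}(q-q^{-1})^2e_4$, $D_0=-q^{-3}(1-q)^2(1+q)(e_4+qe_2+q^2)$, $D_1=-q^{-3}(1-q)^2(1+q)(e_1e_4+qe_3)$, $$Q_0=q^{-4}(1-q)^2\bigl(q^4(e_4-e_2)+q^3(e_1^2-e_1e_3-2e_2)-q^2(e_2e_4+2e_4+e_2)+q(e_3^2-2e_2e_4-e_1e_3)+e_4(1-e_2)\bigr),$$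 $E=-q^{-2}(1-q)^3(c+d)$, $F_0=q^{-3}(1-q)^3(1+q)(cd+q)$, $F_1=q^{-3}(1-q)^3(1+q)(a+b)cd$, $$G=-q^{-4}(1-q)^3\bigl((a+b)(c+d)(cd(q^2+1)+q)-q(ab+1)((c^2+d^2)(q+1)-cd)+(cd+e_4)(q^2+1)+(e_2+e_4-ab)q^3\bigr).$$ The algebra $AW(3,Q_0)$ is generated by $K_0,K_1$ with relations $$(q+q^{-1})K_1K_0K_1-K_1^2K_0-K_0K_1^2=BK_1+C_0K_0+D_0,$$ $$(q+q^{-1})K_0K_1K_0-K_0^2K_1-K_1K_0^2=BK_0+C_1K_1+D_1,$$ and $Q=Q_0$, where $$Q=K_1K_0K_1K_0-(q^2+1+q^{-2})K_0K_1K_0K_1+(q+q^{-1})K_0^2K_1^2+(q+q^{-1})(C_0K_0^2+C_1K_1^2)$$ $$+B\bigl((q+1+q^{-1})K_0K_1+K_1K_0\bigr)+(q+1+q^{-1})(D_0K_0+D_1K_1).$$ The algebra $\widetilde{AW}(3,Q_0)$ is generated by $K_0,K_1,T_1$ such that $(T_1+ab)(T_1+1)=0$, $T_1$ commutes with $K_0,K_1$, and $$(q+q^{-1})K_1K_0K_1-K_1^2K_0-K_0K_1^2=BK_1+C_0K_0+D_0+EK_1(T_1+ab)+F_0(T_1+ab),$$ $$(q+q^{-1})K_0K_1K_0-K_0^2K_1-K_1K_0^2=BK_0+C_1K_1+D_1+EK_0(T_1+ab)+F_1(T_1+ab),$$ $$Q_0=(K_1K_0)^2-(q^2+1+q^{-2})K_0(K_1K_0)K_1+(q+q^{-1})K_0^2K_1^2+(q+q^{-1})(C_0K_0^2+C_1K_1^2)$$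 $$+\bigl(B+E(T_1+ab)\bigr)\bigl((q+1+q^{-1})K_0K_1+K_1K_0\bigr)+(q+1+q^{-1})\bigl(D_0+F_0(T_1+ab)\bigr)K_0$$ $$+(q+1+q^{-1})\bigl(D_1+F_1(T_1+ab)\bigr)K_1+G(T_1+ab).$$ The double affine Hecke algebra $\tilde{\mathfrak H}$ (type $(C_1^\vee,C_1)$) is generated by $T_1,Y,Y^{-1},Z,Z^{-1}$ with relations $YY^{-1}=1=Y^{-1}Y$, $ZZ^{-1}=1=Z^{-1}Z$ and $T_1^2=-(ab+1)T_1-ab$, $T_1Z=Z^{-1}T_1+(ab+1)Z^{-1}-(a+b)$, $T_1Z^{-1}=ZT_1-(ab+1)Z^{-1}+(a+b)$, $T_1Y=q^{-1}abcd\,Y^{-1}T_1-(ab+1)Y+ab(1+q^{-1}cd)$, $T_1Y^{-1}=q(abcd)^{-1}YT_1+q(abcd)^{-1}(1+ab)Y-q(cd)^{-1}(1+q^{-1}cd)$, $YZ=qZY+(1+ab)cd\,Z^{-1}Y^{-1}T_1-(a+b)cd\,Y^{-1}T_1-(1+q^{-1}cd)Z^{-1}T_1-(1-q)(1+ab)(1+q^{-1}cd)Z^{-1}+(c+d)T_1+(1-q)(a+b)(1+q^{-1}cd)$, $YZ^{-1}=q^{-1}Z^{-1}Y-q^{-2}(1+ab)cd\,Z^{-1}Y^{-1}T_1+q^{-2}(a+b)cd\,Y^{-1}T_1+q^{-1}(1+q^{-1}cd)Z^{-1}T_1-q^{-1}(c+d)T_1$, $Y^{-1}Z=q^{-1}ZY^{-1}-q(ab)^{-1}(1+ab)Z^{-1}Y^{-1}T_1+(ab)^{-1}(a+b)Y^{-1}T_1+q(abcd)^{-1}(1+q^{-1}cd)Z^{-1}T_1+q(abcd)^{-1}(1-q)(1+ab)(1+q^{-1}cd)Z^{-1}-(abcd)^{-1}(c+d)T_1-(abcd)^{-1}(1-q)(1+ab)(c+d)$,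 $Y^{-1}Z^{-1}=qZ^{-1}Y^{-1}+q(ab)^{-1}(1+ab)Z^{-1}Y^{-1}T_1-(ab)^{-1}(a+b)Y^{-1}T_1-q^2(abcd)^{-1}(1+q^{-1}cd)Z^{-1}T_1+q(abcd)^{-1}(c+d)T_1$. It is known (earlier work) that there is a unique injective algebra homomorphism $\widetilde{AW}(3,Q_0)\to\tilde{\mathfrak H}$ with $K_0\mapsto Y+q^{-1}abcd\,Y^{-1}$, $K_1\mapsto Z+Z^{-1}$, $T_1\mapsto T_1$; via it $\widetilde{AW}(3,Q_0)$ is regarded as a subalgebra of $\tilde{\mathfrak H}$ (its elements commute with $T_1$). $P_{\rm sym}=(1-ab)^{-1}(T_1+1)\in\tilde{\mathfrak H}$, which is idempotent. The image $S(\tilde{\mathfrak H})=P_{\rm sym}\tilde{\mathfrak H}P_{\rm sym}$ is closed under multiplication, with unit $P_{\rm sym}$, and is called the spherical subalgebra of $\tilde{\mathfrak H}$. *)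

theory Defs
  imports Complex_Main "HOL-Library.Poly_Mapping" "HOL-Algebra.QuotRing" "HOL-Algebra.Module"
begin

section \<open>Algebras over the complex numbers by generators and relations\<close>

text \<open>
  Words form the free monoid under concatenation. With this instance the convolution product of
  \<open>HOL-Library.Poly_Mapping\<close> makes the finitely supported functions on words the free
  associative unital algebra.
\<close>

instantiation list :: (type) monoid_add
begin

definition zero_list :: "'a list" where "zero_list = []"

definition plus_list :: "'a list \<Rightarrow> 'a list \<Rightarrow> 'a list" where "plus_list u v = u @ v"

instance by standard (simp_all add: zero_list_def plus_list_def)

end

type_synonym 'g free_algebra = "'g list \<Rightarrow>\<^sub>0 complex"

definition gen :: "'g \<Rightarrow> 'g free_algebra" where
  "gen g = Poly_Mapping.single [g] 1"

definition scale :: "complex \<Rightarrow> 'g free_algebra \<Rightarrow> 'g free_algebra" (infixr "*\<^sub>C" 75) where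
  "k *\<^sub>C p = Poly_Mapping.single [] k * p"

definition free_ring :: "'g free_algebra ring" where
  "free_ring = \<lparr>carrier = UNIV, mult = (*), one = 1, zero = 0, add = (+)\<rparr>"

text \<open>A set of defining relations is a set of pairs (left-hand side, right-hand side).\<close>

definition relation_ideal ::
    "('g free_algebra \<times> 'g free_algebra) set \<Rightarrow> 'g free_algebra set" where
  "relation_ideal R = genideal free_ring {l - r | l r. (l, r) \<in> R}"

definition presented_class ::
    "('g free_algebra \<times> 'g free_algebra) set \<Rightarrow> 'g free_algebra \<Rightarrow> 'g free_algebra set" where
  "presented_class R p = relation_ideal R +>\<^bsub>free_ring\<^esub> p"

text \<open>
  Noncommutative algebras are represented by the record type \<^typ>\<open>('a, 'b) module\<close>: the
  locale \<open>algebra\<close> of \<open>HOL-Algebra\<close> requires commutativity and cannot be used.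
\<close>

definition presented_algebra ::
    "('g free_algebra \<times> 'g free_algebra) set \<Rightarrow> (complex, 'g free_algebra set) module" where
  "presented_algebra R =
     (let A = free_ring Quot relation_ideal R
      in ring.extend A
           (module.fields (\<lambda>k X. presented_class R (k *\<^sub>C 1) \<otimes>\<^bsub>A\<^esub> X)))"

definition alg_hom ::
    "(complex, 'a, 'm) module_scheme \<Rightarrow> (complex, 'b, 'n) module_scheme \<Rightarrow> ('a \<Rightarrow> 'b) set" where
  "alg_hom A B =
     {h \<in> ring_hom A B. \<forall>k. \<forall>x \<in> carrier A. h (k \<odot>\<^bsub>A\<^esub> x) = k \<odot>\<^bsub>B\<^esub> h x}"

definition alg_iso ::
    "(complex, 'a, 'm) module_scheme \<Rightarrow> (complex, 'b, 'n) module_scheme \<Rightarrow> ('a \<Rightarrow> 'b) set" where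
  "alg_iso A B = {h \<in> alg_hom A B. bij_betw h (carrier A) (carrier B)}"


section \<open>The Askey--Wilson algebras and the double affine Hecke algebra\<close>

datatype aw_gen = AW_K0 | AW_K1

datatype awt_gen = AWT_K0 | AWT_K1 | AWT_T1

datatype daha_gen = H_T1 | H_Y | H_Yinv | H_Z | H_Zinv

fun awt_of_aw :: "aw_gen \<Rightarrow> awt_gen" where
  "awt_of_aw AW_K0 = AWT_K0"
| "awt_of_aw AW_K1 = AWT_K1"

text \<open>The linear extension of the map that sends a word in \<open>K\<^sub>0, K\<^sub>1\<close> to the same word.\<close>

definition tilde :: "aw_gen free_algebra \<Rightarrow> awt_gen free_algebra" where
  "tilde U = (\<Sum>w \<in> Poly_Mapping.keys U.
      Poly_Mapping.single (map awt_of_aw w) (Poly_Mapping.lookup U w))"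

text \<open>
  The locale only makes the parameters implicit; the standing assumptions on them are hypotheses
  of the theorem.
\<close>

locale askey_wilson =
  fixes q a b c d :: complex
begin

definition e1 :: complex where "e1 = a + b + c + d"
definition e2 :: complex where "e2 = a*b + a*c + b*c + a*d + b*d + c*d"
definition e3 :: complex where "e3 = a*b*c + a*b*d + a*c*d + b*c*d"
definition e4 :: complex where "e4 = a*b*c*d"

definition B :: complex where "B = (1 - 1/q)^2 * (e3 + q*e1)"
definition C0 :: complex where "C0 = (q - 1/q)^2"
definition C1 :: complex where "C1 = 1/q * (q - 1/q)^2 * e4"
definition D0 :: complex where
  "D0 = - (1/q^3) * (1 - q)^2 * (1 + q) * (e4 + q*e2 + q^2)"
definition D1 :: complex where
  "D1 = - (1/q^3) * (1 - q)^2 * (1 + q) * (e1*e4 + q*e3)"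
definition Q0 :: complex where
  "Q0 = 1/q^4 * (1 - q)^2 *
     (q^4 * (e4 - e2) + q^3 * (e1^2 - e1*e3 - 2*e2) - q^2 * (e2*e4 + 2*e4 + e2)
      + q * (e3^2 - 2*e2*e4 - e1*e3) + e4 * (1 - e2))"
definition E :: complex where "E = - (1/q^2) * (1 - q)^3 * (c + d)"
definition F0 :: complex where "F0 = 1/q^3 * (1 - q)^3 * (1 + q) * (c*d + q)"
definition F1 :: complex where "F1 = 1/q^3 * (1 - q)^3 * (1 + q) * (a + b) * c*d"
definition G :: complex where
  "G = - (1/q^4) * (1 - q)^3 *
     ((a + b) * (c + d) * (c*d * (q^2 + 1) + q)
      - q * (a*b + 1) * ((c^2 + d^2) * (q + 1) - c*d)
      + (c*d + e4) * (q^2 + 1) + (e2 + e4 - a*b) * q^3)"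

definition AW_relations :: "(aw_gen free_algebra \<times> aw_gen free_algebra) set" where
  "AW_relations =
     (let K0 = gen AW_K0; K1 = gen AW_K1 in
      {((q + 1/q) *\<^sub>C (K1*K0*K1) - K1^2*K0 - K0*K1^2,
          B *\<^sub>C K1 + C0 *\<^sub>C K0 + D0 *\<^sub>C 1),
       ((q + 1/q) *\<^sub>C (K0*K1*K0) - K0^2*K1 - K1*K0^2,
          B *\<^sub>C K0 + C1 *\<^sub>C K1 + D1 *\<^sub>C 1),
       (K1*K0*K1*K0 - (q^2 + 1 + 1/q^2) *\<^sub>C (K0*K1*K0*K1) + (q + 1/q) *\<^sub>C (K0^2*K1^2)
          + (q + 1/q) *\<^sub>C (C0 *\<^sub>C K0^2 + C1 *\<^sub>C K1^2)
          + B *\<^sub>C ((q + 1 + 1/q) *\<^sub>C (K0*K1) + K1*K0)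
          + (q + 1 + 1/q) *\<^sub>C (D0 *\<^sub>C K0 + D1 *\<^sub>C K1),
        Q0 *\<^sub>C 1)})"

definition AWT_relations :: "(awt_gen free_algebra \<times> awt_gen free_algebra) set" where
  "AWT_relations =
     (let K0 = gen AWT_K0; K1 = gen AWT_K1; T1 = gen AWT_T1; W = T1 + (a*b) *\<^sub>C 1 in
      {(W * (T1 + 1), 0),
       (T1*K0, K0*T1),
       (T1*K1, K1*T1),
       ((q + 1/q) *\<^sub>C (K1*K0*K1) - K1^2*K0 - K0*K1^2,
          B *\<^sub>C K1 + C0 *\<^sub>C K0 + D0 *\<^sub>C 1 + E *\<^sub>C (K1*W) + F0 *\<^sub>C W),
       ((q + 1/q) *\<^sub>C (K0*K1*K0) - K0^2*K1 - K1*K0^2,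
          B *\<^sub>C K0 + C1 *\<^sub>C K1 + D1 *\<^sub>C 1 + E *\<^sub>C (K0*W) + F1 *\<^sub>C W),
       (Q0 *\<^sub>C 1,
        (K1*K0)^2 - (q^2 + 1 + 1/q^2) *\<^sub>C (K0*(K1*K0)*K1) + (q + 1/q) *\<^sub>C (K0^2*K1^2)
          + (q + 1/q) *\<^sub>C (C0 *\<^sub>C K0^2 + C1 *\<^sub>C K1^2)
          + (B *\<^sub>C 1 + E *\<^sub>C W) * ((q + 1 + 1/q) *\<^sub>C (K0*K1) + K1*K0)
          + (q + 1 + 1/q) *\<^sub>C ((D0 *\<^sub>C 1 + F0 *\<^sub>C W) * K0)
          + (q + 1 + 1/q) *\<^sub>C ((D1 *\<^sub>C 1 + F1 *\<^sub>C W) * K1)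
          + G *\<^sub>C W)})"

definition DAHA_relations :: "(daha_gen free_algebra \<times> daha_gen free_algebra) set" where
  "DAHA_relations =
     (let T1 = gen H_T1; Y = gen H_Y; Yi = gen H_Yinv; Z = gen H_Z; Zi = gen H_Zinv in
      {(Y*Yi, 1), (Yi*Y, 1), (Z*Zi, 1), (Zi*Z, 1),
       (T1^2, - ((a*b + 1) *\<^sub>C T1) - (a*b) *\<^sub>C 1),
       (T1*Z, Zi*T1 + (a*b + 1) *\<^sub>C Zi - (a + b) *\<^sub>C 1),
       (T1*Zi, Z*T1 - (a*b + 1) *\<^sub>C Zi + (a + b) *\<^sub>C 1),
       (T1*Y, (1/q * (a*b*c*d)) *\<^sub>C (Yi*T1) - (a*b + 1) *\<^sub>C Y
          + (a*b * (1 + 1/q * (c*d))) *\<^sub>C 1),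
       (T1*Yi, (q / (a*b*c*d)) *\<^sub>C (Y*T1) + (q / (a*b*c*d) * (1 + a*b)) *\<^sub>C Y
          - (q / (c*d) * (1 + 1/q * (c*d))) *\<^sub>C 1),
       (Y*Z,
          q *\<^sub>C (Z*Y) + ((1 + a*b) * (c*d)) *\<^sub>C (Zi*Yi*T1)
          - ((a + b) * (c*d)) *\<^sub>C (Yi*T1)
          - (1 + 1/q * (c*d)) *\<^sub>C (Zi*T1)
          - ((1 - q) * (1 + a*b) * (1 + 1/q * (c*d))) *\<^sub>C Zi
          + (c + d) *\<^sub>C T1
          + ((1 - q) * (a + b) * (1 + 1/q * (c*d))) *\<^sub>C 1),
       (Y*Zi,
          (1/q) *\<^sub>C (Zi*Y) - (1/q^2 * (1 + a*b) * (c*d)) *\<^sub>C (Zi*Yi*T1)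
          + (1/q^2 * (a + b) * (c*d)) *\<^sub>C (Yi*T1)
          + (1/q * (1 + 1/q * (c*d))) *\<^sub>C (Zi*T1)
          - (1/q * (c + d)) *\<^sub>C T1),
       (Yi*Z,
          (1/q) *\<^sub>C (Z*Yi) - (q / (a*b) * (1 + a*b)) *\<^sub>C (Zi*Yi*T1)
          + (1 / (a*b) * (a + b)) *\<^sub>C (Yi*T1)
          + (q / (a*b*c*d) * (1 + 1/q * (c*d))) *\<^sub>C (Zi*T1)
          + (q / (a*b*c*d) * (1 - q) * (1 + a*b) * (1 + 1/q * (c*d))) *\<^sub>C Zi
          - (1 / (a*b*c*d) * (c + d)) *\<^sub>C T1
          - (1 / (a*b*c*d) * (1 - q) * (1 + a*b) * (c + d)) *\<^sub>C 1),
       (Yi*Zi,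
          q *\<^sub>C (Zi*Yi) + (q / (a*b) * (1 + a*b)) *\<^sub>C (Zi*Yi*T1)
          - (1 / (a*b) * (a + b)) *\<^sub>C (Yi*T1)
          - (q^2 / (a*b*c*d) * (1 + 1/q * (c*d))) *\<^sub>C (Zi*T1)
          + (q / (a*b*c*d) * (c + d)) *\<^sub>C T1)})"

definition AW :: "(complex, aw_gen free_algebra set) module" where
  "AW = presented_algebra AW_relations"

definition AWT :: "(complex, awt_gen free_algebra set) module" where
  "AWT = presented_algebra AWT_relations"

definition DAHA :: "(complex, daha_gen free_algebra set) module" where
  "DAHA = presented_algebra DAHA_relations"

definition AW_class :: "aw_gen free_algebra \<Rightarrow> aw_gen free_algebra set" where
  "AW_class = presented_class AW_relations"

definition AWT_class :: "awt_gen free_algebra \<Rightarrow> awt_gen free_algebra set" where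
  "AWT_class = presented_class AWT_relations"

definition DAHA_class :: "daha_gen free_algebra \<Rightarrow> daha_gen free_algebra set" where
  "DAHA_class = presented_class DAHA_relations"

definition P_sym :: "daha_gen free_algebra set" where
  "P_sym = (1 / (1 - a*b)) \<odot>\<^bsub>DAHA\<^esub> (DAHA_class (gen H_T1) \<oplus>\<^bsub>DAHA\<^esub> \<one>\<^bsub>DAHA\<^esub>)"

definition S :: "daha_gen free_algebra set \<Rightarrow> daha_gen free_algebra set" where
  "S U = P_sym \<otimes>\<^bsub>DAHA\<^esub> U \<otimes>\<^bsub>DAHA\<^esub> P_sym"

text \<open>The operations are those of \<open>DAHA\<close>, but the unit is \<open>P_sym\<close>.\<close>

definition spherical :: "(complex, daha_gen free_algebra set) module" where
  "spherical = DAHA\<lparr>carrier := S ` carrier DAHA, one := P_sym\<rparr>"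

end

end

theory Submission
  imports Defs
begin

text \<open>
  Write \<open>R = T\<^sub>1 + 1\<close>, a multiple of \<open>P\<^sub>s\<^sub>y\<^sub>m\<close>, so that \<open>T\<^sub>1 R = - a b R\<close>, and let \<open>H\<^sub>0\<close>, \<open>H\<^sub>1\<close>
  be the images of \<open>K\<^sub>0\<close>, \<open>K\<^sub>1\<close> in the double affine Hecke algebra; both commute with \<open>T\<^sub>1\<close>.

  Surjectivity: since Laurent polynomials in \<open>Z\<close> are free over the polynomials in \<open>H\<^sub>1\<close> with
  basis \<open>1, Z\<close>, and similarly for \<open>Y\<close> and \<open>H\<^sub>0\<close>, the left ideal generated by \<open>R\<close> is spanned by
  the elements \<open>H\<^sub>1\<^sup>m x R H\<^sub>0\<^sup>n\<close> with \<open>x\<close> one of \<open>1, Z, Y, Z Y\<close>. Multiplication by \<open>R\<close> from the left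
  passes \<open>H\<^sub>1\<^sup>m\<close>, so it suffices to write the four elements \<open>R x R\<close> as polynomials in
  \<open>H\<^sub>0\<close>, \<open>H\<^sub>1\<close> times \<open>R\<close>. For \<open>x = Z Y\<close> the leading part is
  \<open>(q H\<^sub>0 H\<^sub>1 - H\<^sub>1 H\<^sub>0) / (q\<^sup>2 - 1)\<close>.

  Injectivity: substituting \<open>T\<^sub>1 = - a b\<close> turns the relations of the extended algebra into those
  of \<open>AW(3,Q\<^sub>0)\<close>, and it sends the word image of \<open>U\<close> times \<open>T\<^sub>1 + 1\<close> to \<open>(1 - a b) U\<close>.
\<close>


section \<open>Free and presented algebras\<close>

lemma single_Nil_1 [simp]: "Poly_Mapping.single ([] :: 'g list) (1 :: complex) = 1"
  by (metis single_one zero_list_def)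

lemma sum_single_lookup:
  "(\<Sum>w \<in> Poly_Mapping.keys p. Poly_Mapping.single w (Poly_Mapping.lookup p w)) = p"
proof (rule poly_mapping_eqI)
  fix k
  show "Poly_Mapping.lookup (\<Sum>w \<in> Poly_Mapping.keys p. Poly_Mapping.single w (Poly_Mapping.lookup p w)) k
      = Poly_Mapping.lookup p k"
    by (simp add: lookup_sum lookup_single when_def in_keys_iff)
qed

lemma scale_single: "k *\<^sub>C Poly_Mapping.single w l = Poly_Mapping.single w (k * l)"
  by (simp add: scale_def mult_single plus_list_def)

lemma lookup_scale [simp]: "Poly_Mapping.lookup (k *\<^sub>C p) w = k * Poly_Mapping.lookup p w"
proof -
  have "k *\<^sub>C p = (\<Sum>v \<in> Poly_Mapping.keys p. Poly_Mapping.single v (k * Poly_Mapping.lookup p v))"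
    by (subst sum_single_lookup [symmetric, of p])
      (simp add: scale_def sum_distrib_left mult_single plus_list_def)
  then show ?thesis
    by (simp add: lookup_sum lookup_single when_def in_keys_iff)
qed

lemma single_eq_scale: "Poly_Mapping.single w k = k *\<^sub>C prod_list (map gen w)"
proof -
  have "Poly_Mapping.single w (1::complex) = prod_list (map gen w)"
  proof (induction w)
    case (Cons g w)
    have "Poly_Mapping.single (g # w) (1::complex) = gen g * Poly_Mapping.single w 1"
      by (simp add: gen_def mult_single plus_list_def)
    then show ?case using Cons by simp
  qed simp
  then show ?thesis using scale_single [of k w 1] by simp
qed

text \<open>Words span the free algebra and arise from \<open>1\<close> by left multiplication with
  generators. The zero element needs no case of its own, being a multiple of
  \<open>1\<close>.\<close>

lemma free_algebra_induct [case_names one gen scale add]: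
  assumes one: "P 1"
    and gen: "\<And>g p. P p \<Longrightarrow> P (gen g * p)"
    and scale: "\<And>k p. P p \<Longrightarrow> P (k *\<^sub>C p)"
    and add: "\<And>p q. P p \<Longrightarrow> P q \<Longrightarrow> P (p + q)"
  shows "P p"
proof -
  have word: "P (prod_list (map gen w))" for w
    by (induction w) (simp_all add: one gen)
  have "0 = 0 *\<^sub>C (1 :: 'a free_algebra)"
    by (simp add: scale_def)
  then have zero: "P 0"
    using scale [OF one, of 0] by simp
  have "P (\<Sum>w \<in> A. Poly_Mapping.single w (f w))" if "finite A" for A f
    using that by induction (simp_all add: zero add single_eq_scale scale word)
  from this [of "Poly_Mapping.keys p" "Poly_Mapping.lookup p"] show ?thesis
    by (simp add: sum_single_lookup)
qed

lemma
  shows scale_1 [simp]: "1 *\<^sub>C p = p"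
    and scale_minus_1 [simp]: "(-1) *\<^sub>C p = - p"
    and scale_minus_left [simp]: "(- k) *\<^sub>C p = - (k *\<^sub>C p)"
    and scale_0 [simp]: "0 *\<^sub>C p = 0"
    and scale_zero_right [simp]: "k *\<^sub>C 0 = 0"
    and scale_scale [simp]: "k *\<^sub>C l *\<^sub>C p = (k * l) *\<^sub>C p"
    and scale_add: "k *\<^sub>C (p + q) = k *\<^sub>C p + k *\<^sub>C q"
    and scale_diff: "k *\<^sub>C (p - q) = k *\<^sub>C p - k *\<^sub>C q"
    and scale_uminus [simp]: "k *\<^sub>C (- p) = - (k *\<^sub>C p)"
    and scale_add_left: "(k + l) *\<^sub>C p = k *\<^sub>C p + l *\<^sub>C p"
  by (rule poly_mapping_eqI; simp add: lookup_add lookup_minus algebra_simps)+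

lemma scale_mult_left [simp]: "(k *\<^sub>C p) * q = k *\<^sub>C (p * q)"
  by (simp add: scale_def mult.assoc)

text \<open>Scaling is left multiplication by a multiple of the empty word; the content is that this
  element is central. It commutes with each generator, hence with everything.\<close>

lemma scale_mult_right [simp]: "p * (k *\<^sub>C q) = k *\<^sub>C (p * q)"
proof -
  have "p * (k *\<^sub>C 1) = k *\<^sub>C p"
  proof (induction p rule: free_algebra_induct)
    case (gen g p)
    have "gen g * k *\<^sub>C p = k *\<^sub>C (gen g * p)"
    proof -
      have "gen g * Poly_Mapping.single [] k = Poly_Mapping.single [] k * gen g"
        by (simp add: gen_def mult_single plus_list_def)
      then show ?thesis by (simp add: scale_def flip: mult.assoc)
    qed
    then show ?case using gen by (simp add: mult.assoc)
  next
    case (scale l p)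
    then show ?case by (simp add: mult.commute)
  qed (simp_all add: scale_add algebra_simps)
  then have "p * (k *\<^sub>C 1) * q = (k *\<^sub>C p) * q" by simp
  then show ?thesis by (simp add: mult.assoc)
qed

lemma scale_sum: "k *\<^sub>C (\<Sum>x\<in>A. h x) = (\<Sum>x\<in>A. k *\<^sub>C h x)"
  by (simp add: scale_def sum_distrib_left)

text \<open>
  Linear identities in the free algebra are checked coefficient by coefficient, with
  \<open>poly_mapping_eqI\<close>; this reduces them to field identities between the scalars, where
  products of generators are opaque.
\<close>

lemmas free_algebra_simps = algebra_simps scale_add scale_diff power2_eq_square


section \<open>Homomorphisms given by the universal property of the free algebra\<close>

definition subst :: "('g \<Rightarrow> 'h free_algebra) \<Rightarrow> 'g free_algebra \<Rightarrow> 'h free_algebra" where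
  "subst f p = (\<Sum>w \<in> Poly_Mapping.keys p. Poly_Mapping.lookup p w *\<^sub>C prod_list (map f w))"

lemma subst_0 [simp]: "subst f 0 = 0"
  by (simp add: subst_def)

lemma subst_add [simp]: "subst f (p + r) = subst f p + subst f r"
  unfolding subst_def
  by (rule setsum_keys_plus_distrib) (simp_all add: scale_add_left)

lemma subst_scale [simp]: "subst f (k *\<^sub>C p) = k *\<^sub>C subst f p"
proof (cases "k = 0")
  case False
  then have "Poly_Mapping.keys (k *\<^sub>C p) = Poly_Mapping.keys p"
    by (auto simp: in_keys_iff)
  then show ?thesis by (simp add: subst_def scale_sum)
qed (simp add: subst_def)

lemma subst_diff [simp]: "subst f (p - r) = subst f p - subst f r"
  using subst_add [of f "p - r" r] by (simp add: algebra_simps)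

lemma subst_word [simp]: "subst f (prod_list (map gen w)) = prod_list (map f w)"
proof -
  have "subst f (Poly_Mapping.single w 1) = prod_list (map f w)"
    by (simp add: subst_def)
  then show ?thesis by (simp add: single_eq_scale)
qed

lemma subst_1 [simp]: "subst f 1 = 1"
  using subst_word [of f "[]"] by simp

lemma subst_gen [simp]: "subst f (gen g) = f g"
  using subst_word [of f "[g]"] by simp

lemma subst_gen_mult: "subst f (gen g * p) = f g * subst f p"
proof -
  have "subst f (gen g * Poly_Mapping.single w k) = f g * subst f (Poly_Mapping.single w k)" for w k
    using subst_word [of f "g # w"] by (simp add: single_eq_scale)
  note single = this
  have "subst f (gen g * (\<Sum>w\<in>A. Poly_Mapping.single w (h w)))
      = f g * subst f (\<Sum>w\<in>A. Poly_Mapping.single w (h w))" if "finite A" for A h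
    using that by induction (simp_all add: distrib_left single)
  from this [of "Poly_Mapping.keys p" "Poly_Mapping.lookup p"] show ?thesis
    by (simp add: sum_single_lookup)
qed

lemma subst_mult [simp]: "subst f (p * r) = subst f p * subst f r"
  by (induction p rule: free_algebra_induct)
    (simp_all add: mult.assoc subst_gen_mult distrib_right)

lemma subst_power [simp]: "subst f (p ^ n) = subst f p ^ n"
  by (induction n) simp_all

lemma subst_subst: "subst f (subst h p) = subst (\<lambda>g. subst f (h g)) p"
  by (induction p rule: free_algebra_induct) simp_all

lemma subst_gens [simp]: "subst gen p = p"
  by (induction p rule: free_algebra_induct) simp_all

text \<open>This makes the word map available as an algebra homomorphism, which its definition as a
  sum over words hides.\<close>

lemma tilde_eq_subst: "tilde U = subst (\<lambda>g. gen (awt_of_aw g)) U"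
  by (simp add: tilde_def subst_def single_eq_scale comp_def)


section \<open>The free algebra as a ring and its two-sided ideals\<close>

lemma ring_free_ring: "ring (free_ring :: 'g free_algebra ring)"
proof (rule ringI)
  show "abelian_group (free_ring :: 'g free_algebra ring)"
  proof (rule abelian_groupI)
    fix x :: "'g free_algebra"
    show "\<exists>y\<in>carrier free_ring. y \<oplus>\<^bsub>free_ring\<^esub> x = \<zero>\<^bsub>free_ring\<^esub>"
      by (intro bexI [of _ "- x"]) (simp_all add: free_ring_def)
  qed (simp_all add: free_ring_def algebra_simps)
  show "Group.monoid (free_ring :: 'g free_algebra ring)"
    by (rule monoidI) (simp_all add: free_ring_def algebra_simps)
qed (simp_all add: free_ring_def algebra_simps)

lemma a_inv_free_ring: "\<ominus>\<^bsub>free_ring\<^esub> p = - p"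
  for p :: "'g free_algebra"
proof -
  interpret ring "free_ring :: 'g free_algebra ring" by (rule ring_free_ring)
  show ?thesis
    using minus_equality [of "- p" p] by (simp add: free_ring_def)
qed

text \<open>Negation is absent from the right-hand side because \<open>- x\<close> is the product of
  \<open>-1\<close> and \<open>x\<close>.\<close>

lemma ideal_free_ring_iff:
  "ideal J free_ring \<longleftrightarrow> 0 \<in> J \<and> (\<forall>x\<in>J. \<forall>y\<in>J. x + y \<in> J) \<and> (\<forall>x\<in>J. \<forall>p. p * x \<in> J \<and> x * p \<in> J)"
  (is "_ \<longleftrightarrow> ?rhs")
proof
  assume "ideal J free_ring"
  then interpret ideal J free_ring .
  show ?rhs
    using additive_subgroup.zero_closed [OF is_additive_subgroup]
      additive_subgroup.a_closed [OF is_additive_subgroup] I_l_closed I_r_closed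
    by (simp add: free_ring_def)
next
  assume J: ?rhs
  then have "- x \<in> J" if "x \<in> J" for x
    using that by (metis mult_minus1)
  moreover have "inv\<^bsub>add_monoid free_ring\<^esub> x = - x" for x :: "'a free_algebra"
    using a_inv_free_ring [of x] by (simp add: a_inv_def)
  ultimately have "subgroup J (add_monoid free_ring)"
    using J by (intro subgroup.intro) (simp_all only:, auto simp: free_ring_def)
  then show "ideal J free_ring"
    using J by (intro idealI ring_free_ring) (simp_all add: free_ring_def)
qed

section \<open>Congruence modulo the defining relations\<close>

definition eq_mod ::
    "('g free_algebra \<times> 'g free_algebra) set \<Rightarrow> 'g free_algebra \<Rightarrow> 'g free_algebra \<Rightarrow> bool" where
  "eq_mod R p r \<longleftrightarrow> p - r \<in> relation_ideal R"

text \<open>Congruence depends only on the difference of the two sides. Computations below therefore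
  form a linear combination of known congruences and leave an identity in the free algebra to
  check.\<close>

lemma eq_mod_rebalance: "eq_mod R p r \<Longrightarrow> p' - r' = p - r \<Longrightarrow> eq_mod R p' r'"
  by (simp add: eq_mod_def)

lemma ideal_relation_ideal: "ideal (relation_ideal R) free_ring"
  unfolding relation_ideal_def
  by (rule ring.genideal_ideal [OF ring_free_ring]) (simp add: free_ring_def)

lemma relation_ideal_minimal:
  assumes "0 \<in> J" "\<And>x y. x \<in> J \<Longrightarrow> y \<in> J \<Longrightarrow> x + y \<in> J"
    and "\<And>p x. x \<in> J \<Longrightarrow> p * x \<in> J" "\<And>p x. x \<in> J \<Longrightarrow> x * p \<in> J"
    and "\<And>l r. (l, r) \<in> R \<Longrightarrow> l - r \<in> J"
  shows "relation_ideal R \<subseteq> J"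
  unfolding relation_ideal_def
  by (rule ring.genideal_minimal [OF ring_free_ring])
    (use assms in \<open>auto simp: ideal_free_ring_iff\<close>)

lemma eq_mod_rel: "(l, r) \<in> R \<Longrightarrow> eq_mod R l r"
  unfolding eq_mod_def relation_ideal_def
  using ring.genideal_self [OF ring_free_ring, of "{l - r | l r. (l, r) \<in> R}"]
  by (auto simp: free_ring_def)

lemma
  shows eq_mod_refl [simp]: "eq_mod R p p"
    and eq_mod_add: "eq_mod R p p' \<Longrightarrow> eq_mod R r r' \<Longrightarrow> eq_mod R (p + r) (p' + r')"
    and eq_mod_mult: "eq_mod R p p' \<Longrightarrow> eq_mod R r r' \<Longrightarrow> eq_mod R (p * r) (p' * r')"
    and eq_mod_trans [trans]: "eq_mod R p r \<Longrightarrow> eq_mod R r s \<Longrightarrow> eq_mod R p s"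
proof -
  have I: "0 \<in> relation_ideal R"
    "\<And>x y. x \<in> relation_ideal R \<Longrightarrow> y \<in> relation_ideal R \<Longrightarrow> x + y \<in> relation_ideal R"
    "\<And>x p. x \<in> relation_ideal R \<Longrightarrow> p * x \<in> relation_ideal R"
    "\<And>x p. x \<in> relation_ideal R \<Longrightarrow> x * p \<in> relation_ideal R"
    using ideal_relation_ideal [of R] by (auto simp: ideal_free_ring_iff)
  show "eq_mod R p p" using I(1) by (simp add: eq_mod_def)
  show "eq_mod R p s" if "eq_mod R p r" "eq_mod R r s"
    using that I(2) [of "p - r" "r - s"] by (simp add: eq_mod_def)
  show "eq_mod R (p + r) (p' + r')" if "eq_mod R p p'" "eq_mod R r r'"
    using that I(2) [of "p - p'" "r - r'"] by (simp add: eq_mod_def algebra_simps)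
  have "p * r - p' * r' = (p - p') * r + p' * (r - r')"
    by (simp add: algebra_simps)
  then show "eq_mod R (p * r) (p' * r')" if "eq_mod R p p'" "eq_mod R r r'"
    using that I by (simp add: eq_mod_def)
qed

lemma eq_mod_scale: "eq_mod R p p' \<Longrightarrow> eq_mod R (k *\<^sub>C p) (k *\<^sub>C p')"
  unfolding scale_def by (rule eq_mod_mult) simp_all

lemma eq_mod_diff: "eq_mod R p p' \<Longrightarrow> eq_mod R r r' \<Longrightarrow> eq_mod R (p - r) (p' - r')"
  using eq_mod_add [of R p p' "(-1) *\<^sub>C r" "(-1) *\<^sub>C r'"] eq_mod_scale [of R r r' "-1"] by simp

lemma eq_mod_sym: "eq_mod R p r \<Longrightarrow> eq_mod R r p"
  using eq_mod_diff [of R p p p r] eq_mod_diff [of R p r p p]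
  using eq_mod_add [of R "p - p" "p - r" r r] by simp

text \<open>The elements sent to \<open>0\<close> modulo \<open>R'\<close> form a two-sided ideal;
  containing the relations in \<open>R\<close>, it contains all of
  \<open>relation_ideal R\<close>.\<close>

lemma subst_eq_mod:
  assumes "\<And>l r. (l, r) \<in> R \<Longrightarrow> eq_mod R' (subst f l) (subst f r)"
    and "eq_mod R p r"
  shows "eq_mod R' (subst f p) (subst f r)"
proof -
  have "relation_ideal R \<subseteq> {p. eq_mod R' (subst f p) 0}"
  proof (rule relation_ideal_minimal)
    show "l - r \<in> {p. eq_mod R' (subst f p) 0}" if "(l, r) \<in> R" for l r
      using assms(1) [OF that] by (simp add: eq_mod_def)
    show "x + y \<in> {p. eq_mod R' (subst f p) 0}"
      if "x \<in> {p. eq_mod R' (subst f p) 0}" "y \<in> {p. eq_mod R' (subst f p) 0}" for x y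
      using that eq_mod_add [of R' "subst f x" 0 "subst f y" 0] by simp
    show "p * x \<in> {p. eq_mod R' (subst f p) 0}" if "x \<in> {p. eq_mod R' (subst f p) 0}" for x p
      using that eq_mod_mult [of R' "subst f p" "subst f p" "subst f x" 0] by simp
    show "x * p \<in> {p. eq_mod R' (subst f p) 0}" if "x \<in> {p. eq_mod R' (subst f p) 0}" for x p
      using that eq_mod_mult [of R' "subst f x" 0 "subst f p" "subst f p"] by simp
  qed simp
  then show ?thesis
    using assms(2) by (auto simp: eq_mod_def)
qed

section \<open>Operations of a presented algebra on representatives\<close>

lemma presented_algebra_simps:
  shows carrier_presented_algebra: "carrier (presented_algebra R) = range (presented_class R)"
    and presented_class_mult:
      "presented_class R p \<otimes>\<^bsub>presented_algebra R\<^esub> presented_class R r = presented_class R (p * r)"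
    and presented_class_add:
      "presented_class R p \<oplus>\<^bsub>presented_algebra R\<^esub> presented_class R r = presented_class R (p + r)"
    and presented_class_smult:
      "k \<odot>\<^bsub>presented_algebra R\<^esub> presented_class R p = presented_class R (k *\<^sub>C p)"
    and presented_class_one: "\<one>\<^bsub>presented_algebra R\<^esub> = presented_class R 1"
proof -
  interpret ideal "relation_ideal R" free_ring by (rule ideal_relation_ideal)
  have m: "presented_class R p \<otimes>\<^bsub>free_ring Quot relation_ideal R\<^esub> presented_class R r = presented_class R (p * r)" for p r
    using rcoset_mult_add [of p r] by (simp add: FactRing_def presented_class_def) (simp add: free_ring_def)
  show "presented_class R p \<otimes>\<^bsub>presented_algebra R\<^esub> presented_class R r = presented_class R (p * r)"
    using m by (simp add: presented_algebra_def Let_def ring.defs)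
  show "presented_class R p \<oplus>\<^bsub>presented_algebra R\<^esub> presented_class R r = presented_class R (p + r)"
    using a_rcos_sum [of p r]
    by (simp add: presented_algebra_def Let_def ring.defs FactRing_def presented_class_def) (simp add: free_ring_def)
  show "k \<odot>\<^bsub>presented_algebra R\<^esub> presented_class R p = presented_class R (k *\<^sub>C p)"
    using m by (simp add: presented_algebra_def Let_def ring.defs module.defs)
  show "\<one>\<^bsub>presented_algebra R\<^esub> = presented_class R 1"
    by (simp add: presented_algebra_def Let_def ring.defs FactRing_def presented_class_def)
      (simp add: free_ring_def)
  show "carrier (presented_algebra R) = range (presented_class R)"
    by (auto simp: presented_algebra_def Let_def ring.defs FactRing_def presented_class_def
      A_RCOSETS_def' free_ring_def)
qed

lemma presented_class_eq_iff: "presented_class R p = presented_class R r \<longleftrightarrow> eq_mod R p r"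
  using ring.quotient_eq_iff_same_a_r_cos [OF ring_free_ring ideal_relation_ideal, of p r R]
  by (simp add: presented_class_def eq_mod_def a_minus_def a_inv_free_ring)
    (simp add: free_ring_def)


section \<open>The left ideal generated by \<open>T\<^sub>1 + 1\<close>\<close>

text \<open>The scalars that get inverted: \<open>q2\<close> permits the division by
  \<open>q^2 - 1\<close> in the formula for \<open>R * Z * Y * R\<close>, and \<open>ab\<close>
  makes \<open>R * R\<close> a nonzero multiple of \<open>R\<close>.\<close>

locale daha = askey_wilson +
  assumes q_nz: "q \<noteq> 0" and q2: "q^2 \<noteq> 1"
    and nz: "a \<noteq> 0" "b \<noteq> 0" "c \<noteq> 0" "d \<noteq> 0"
    and ab: "a * b \<noteq> 1"
begin

abbreviation daha_eq (infix "\<approx>" 50) where "p \<approx> r \<equiv> eq_mod DAHA_relations p r"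

abbreviation "T \<equiv> gen H_T1"
abbreviation "Y \<equiv> gen H_Y"
abbreviation "Yi \<equiv> gen H_Yinv"
abbreviation "Z \<equiv> gen H_Z"
abbreviation "Zi \<equiv> gen H_Zinv"
abbreviation "R \<equiv> T + 1"
abbreviation "H0 \<equiv> Y + (1/q * (a*b*c*d)) *\<^sub>C Yi"
abbreviation "H1 \<equiv> Z + Zi"
abbreviation "s \<equiv> 1 + 1/q * (c*d)"

section \<open>The relations applied to \<open>R\<close>\<close>

lemma daha_relations:
  shows Y_Yi: "Y*Yi \<approx> 1" and Yi_Y: "Yi*Y \<approx> 1" and Z_Zi: "Z*Zi \<approx> 1" and Zi_Z: "Zi*Z \<approx> 1"
    and T_T: "T^2 \<approx> - ((a*b + 1) *\<^sub>C T) - (a*b) *\<^sub>C 1"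
    and T_Z: "T*Z \<approx> Zi*T + (a*b + 1) *\<^sub>C Zi - (a + b) *\<^sub>C 1"
    and T_Zi: "T*Zi \<approx> Z*T - (a*b + 1) *\<^sub>C Zi + (a + b) *\<^sub>C 1"
    and T_Y: "T*Y \<approx> (1/q * (a*b*c*d)) *\<^sub>C (Yi*T) - (a*b + 1) *\<^sub>C Y
          + (a*b * (1 + 1/q * (c*d))) *\<^sub>C 1"
    and T_Yi: "T*Yi \<approx> (q / (a*b*c*d)) *\<^sub>C (Y*T) + (q / (a*b*c*d) * (1 + a*b)) *\<^sub>C Y
          - (q / (c*d) * (1 + 1/q * (c*d))) *\<^sub>C 1"
    and Y_Z: "Y*Z \<approx> q *\<^sub>C (Z*Y) + ((1 + a*b) * (c*d)) *\<^sub>C (Zi*Yi*T)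
          - ((a + b) * (c*d)) *\<^sub>C (Yi*T)
          - (1 + 1/q * (c*d)) *\<^sub>C (Zi*T)
          - ((1 - q) * (1 + a*b) * (1 + 1/q * (c*d))) *\<^sub>C Zi
          + (c + d) *\<^sub>C T
          + ((1 - q) * (a + b) * (1 + 1/q * (c*d))) *\<^sub>C 1"
    and Y_Zi: "Y*Zi \<approx> (1/q) *\<^sub>C (Zi*Y) - (1/q^2 * (1 + a*b) * (c*d)) *\<^sub>C (Zi*Yi*T)
          + (1/q^2 * (a + b) * (c*d)) *\<^sub>C (Yi*T)
          + (1/q * (1 + 1/q * (c*d))) *\<^sub>C (Zi*T)
          - (1/q * (c + d)) *\<^sub>C T"
    and Yi_Z: "Yi*Z \<approx> (1/q) *\<^sub>C (Z*Yi) - (q / (a*b) * (1 + a*b)) *\<^sub>C (Zi*Yi*T)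
          + (1 / (a*b) * (a + b)) *\<^sub>C (Yi*T)
          + (q / (a*b*c*d) * (1 + 1/q * (c*d))) *\<^sub>C (Zi*T)
          + (q / (a*b*c*d) * (1 - q) * (1 + a*b) * (1 + 1/q * (c*d))) *\<^sub>C Zi
          - (1 / (a*b*c*d) * (c + d)) *\<^sub>C T
          - (1 / (a*b*c*d) * (1 - q) * (1 + a*b) * (c + d)) *\<^sub>C 1"
    and Yi_Zi: "Yi*Zi \<approx> q *\<^sub>C (Zi*Yi) + (q / (a*b) * (1 + a*b)) *\<^sub>C (Zi*Yi*T)
          - (1 / (a*b) * (a + b)) *\<^sub>C (Yi*T)
          - (q^2 / (a*b*c*d) * (1 + 1/q * (c*d))) *\<^sub>C (Zi*T)
          + (q / (a*b*c*d) * (c + d)) *\<^sub>C T"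
  by (rule eq_mod_rel, simp only: DAHA_relations_def Let_def insert_iff simp_thms)+

lemma T_H1: "T * H1 \<approx> H1 * T"
  by (rule eq_mod_rebalance [OF eq_mod_add [OF T_Z T_Zi]]) (simp add: free_algebra_simps)

text \<open>The weight of \<open>Yi\<close> in \<open>H0\<close> is the one for which the correction
  terms of the two relations cancel.\<close>

lemma T_H0: "T * H0 \<approx> H0 * T"
  by (rule eq_mod_rebalance [OF eq_mod_add [OF T_Y eq_mod_scale [OF T_Yi, of "1/q * (a*b*c*d)"]]],
      rule poly_mapping_eqI)
    (use nz q_nz in \<open>simp add: lookup_add lookup_minus free_algebra_simps field_simps\<close>)

lemma T_R: "T * R \<approx> - (a*b) *\<^sub>C R"
  by (rule eq_mod_rebalance [OF T_T], rule poly_mapping_eqI)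
    (simp add: lookup_add lookup_minus free_algebra_simps)

lemma R_R: "R * R \<approx> (1 - a*b) *\<^sub>C R"
  by (rule eq_mod_rebalance [OF T_R], rule poly_mapping_eqI)
    (simp add: lookup_add lookup_minus free_algebra_simps)

lemma R_commute: "T * p \<approx> p * T \<Longrightarrow> R * p \<approx> p * R"
  by (erule eq_mod_rebalance) (simp add: algebra_simps)

text \<open>In the relations to which this is applied, \<open>T\<close> stands on the right-hand
  side only as a last factor; in front of \<open>R\<close> it acts as the scalar
  \<open>- (a*b)\<close>.\<close>

lemma mult_R: "p \<approx> r + u * T \<Longrightarrow> p * R \<approx> (r - (a*b) *\<^sub>C u) * R"
proof -
  assume "p \<approx> r + u * T"
  then have "p * R \<approx> (r + u * T) * R"
    by (rule eq_mod_mult) simp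
  moreover have "u * (T * R) \<approx> u * (- (a*b) *\<^sub>C R)"
    by (intro eq_mod_mult T_R eq_mod_refl)
  ultimately have "p * R + u * (T * R) \<approx> (r + u * T) * R + u * (- (a*b) *\<^sub>C R)"
    by (rule eq_mod_add)
  then show ?thesis
    by (rule eq_mod_rebalance)
     (rule poly_mapping_eqI, simp add: lookup_add lookup_minus free_algebra_simps)
qed

lemma T_Z_R: "T * Z * R \<approx> (Zi - (a + b) *\<^sub>C 1) * R"
proof -
  have "T * Z * R \<approx> ((a*b + 1) *\<^sub>C Zi - (a + b) *\<^sub>C 1 - (a*b) *\<^sub>C Zi) * R"
    by (rule mult_R, rule eq_mod_rebalance [OF T_Z]) (simp add: free_algebra_simps)
  then show ?thesis
    by (rule eq_mod_rebalance)
     (rule poly_mapping_eqI, simp add: lookup_add lookup_minus free_algebra_simps)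
qed

lemma T_Y_R: "T * Y * R \<approx> ((a*b*s) *\<^sub>C 1 - (a*b + 1) *\<^sub>C Y - (a*b) *\<^sub>C ((1/q * (a*b*c*d)) *\<^sub>C Yi)) * R"
  by (rule mult_R, rule eq_mod_rebalance [OF T_Y]) (simp add: free_algebra_simps)

text \<open>\<open>T\<close> is moved past \<open>Z\<close> and then, in the one term that still has
  it in front of \<open>Y\<close>, past \<open>Y\<close>. The two contributions in
  \<open>Zi * Y\<close> cancel.\<close>

lemma T_Z_Y_R:
  "T * Z * Y * R \<approx> ((a*b*s) *\<^sub>C Zi - (a + b) *\<^sub>C Y - (a*b) *\<^sub>C ((1/q * (a*b*c*d)) *\<^sub>C (Zi * Yi))) * R"
proof -
  have "T * Z * (Y * R) \<approx> (Zi*T + (a*b + 1) *\<^sub>C Zi - (a + b) *\<^sub>C 1) * (Y * R)"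
    by (intro eq_mod_mult T_Z eq_mod_refl)
  moreover have "Zi * (T * Y * R) \<approx> Zi * (((a*b*s) *\<^sub>C 1 - (a*b + 1) *\<^sub>C Y - (a*b) *\<^sub>C ((1/q * (a*b*c*d)) *\<^sub>C Yi)) * R)"
    by (intro eq_mod_mult T_Y_R eq_mod_refl)
  ultimately show ?thesis
    by (rule eq_mod_rebalance [OF eq_mod_add])
     (rule poly_mapping_eqI, simp add: lookup_add lookup_minus free_algebra_simps)
qed

text \<open>With \<open>Z\<close> and \<open>Zi\<close> ordered before \<open>Y\<close> and
  \<open>Yi\<close>, the terms \<open>Zi * Y\<close> and \<open>Z * Yi\<close> cancel in
  \<open>q *\<^sub>C (H0 * H1) - H1 * H0\<close>, while \<open>Z * Y\<close> and
  \<open>Zi * Yi\<close> keep \<open>q^2 - 1\<close> times the coefficients they have in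
  \<open>R * Z * Y * R\<close>. The \<open>Zi\<close> terms match as well, and the multiples of
  \<open>1\<close> and \<open>H0\<close> account for the rest.\<close>

lemma R_Z_Y_R:
  "(q^2 - 1) *\<^sub>C (R * Z * Y * R) \<approx>
    (q *\<^sub>C (H0 * H1) - H1 * H0
      - ((1 - q) * ((a*b - 1) * (c + d) + q * (a + b) * s)) *\<^sub>C 1
      - ((q^2 - 1) * (a + b)) *\<^sub>C H0) * R"
proof -
  note simps = lookup_add lookup_minus free_algebra_simps
  \<comment> \<open>The four products in the expansion of \<open>H0 * H1 * R\<close> are put in
    order, with \<open>T\<close> absorbed into \<open>R\<close>.\<close>
  have 1: "Y * Z * R \<approx>
      (q *\<^sub>C (Z*Y) - ((1 - q) * (1 + a*b) * s) *\<^sub>C Zi + ((1 - q) * (a + b) * s) *\<^sub>C 1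
        - (a*b) *\<^sub>C (((1 + a*b) * (c*d)) *\<^sub>C (Zi*Yi) - ((a + b) * (c*d)) *\<^sub>C Yi
          - s *\<^sub>C Zi + (c + d) *\<^sub>C 1)) * R"
    by (rule mult_R, rule eq_mod_rebalance [OF Y_Z], rule poly_mapping_eqI) (simp add: simps)
  have 2: "Y * Zi * R \<approx>
      ((1/q) *\<^sub>C (Zi*Y)
        - (a*b) *\<^sub>C ((1/q^2 * (a + b) * (c*d)) *\<^sub>C Yi - (1/q^2 * (1 + a*b) * (c*d)) *\<^sub>C (Zi*Yi)
          + (1/q * s) *\<^sub>C Zi - (1/q * (c + d)) *\<^sub>C 1)) * R"
    by (rule mult_R, rule eq_mod_rebalance [OF Y_Zi], rule poly_mapping_eqI) (simp add: simps)
  have 3: "Yi * Z * R \<approx>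
      ((1/q) *\<^sub>C (Z*Yi) + (q / (a*b*c*d) * (1 - q) * (1 + a*b) * s) *\<^sub>C Zi
        - (1 / (a*b*c*d) * (1 - q) * (1 + a*b) * (c + d)) *\<^sub>C 1
        - (a*b) *\<^sub>C ((1 / (a*b) * (a + b)) *\<^sub>C Yi - (q / (a*b) * (1 + a*b)) *\<^sub>C (Zi*Yi)
          + (q / (a*b*c*d) * s) *\<^sub>C Zi - (1 / (a*b*c*d) * (c + d)) *\<^sub>C 1)) * R"
    by (rule mult_R, rule eq_mod_rebalance [OF Yi_Z], rule poly_mapping_eqI) (simp add: simps)
  have 4: "Yi * Zi * R \<approx>
      (q *\<^sub>C (Zi*Yi)
        - (a*b) *\<^sub>C ((q / (a*b) * (1 + a*b)) *\<^sub>C (Zi*Yi) - (1 / (a*b) * (a + b)) *\<^sub>C Yi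
          - (q^2 / (a*b*c*d) * s) *\<^sub>C Zi + (q / (a*b*c*d) * (c + d)) *\<^sub>C 1)) * R"
    by (rule mult_R, rule eq_mod_rebalance [OF Yi_Zi], rule poly_mapping_eqI) (simp add: simps)
  have H0_H1: "H0 * H1 * R = Y * Z * R + Y * Zi * R
      + (1/q * (a*b*c*d)) *\<^sub>C (Yi * Z * R + Yi * Zi * R)"
    by (simp add: free_algebra_simps)
  \<comment> \<open>\<open>q^2 - 1\<close> times \<open>T_Z_Y_R\<close> minus \<open>q\<close> times
    the ordered expansion of \<open>H0 * H1 * R\<close>: all that remains is to compare
    coefficients.\<close>
  note combination = eq_mod_diff [OF eq_mod_scale [OF T_Z_Y_R, of "q^2 - 1"]
      eq_mod_scale [OF eq_mod_add [OF eq_mod_add [OF 1 2]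
        eq_mod_scale [OF eq_mod_add [OF 3 4], of "1/q * (a*b*c*d)"]], of q, folded H0_H1]]
  show ?thesis
    by (rule eq_mod_rebalance [OF combination], rule poly_mapping_eqI)
      (use nz q_nz in \<open>simp add: simps, simp add: field_simps power2_eq_square\<close>)
qed

section \<open>A spanning set of the left ideal\<close>

text \<open>
  The span of the elements \<open>H\<^sub>1\<^sup>m x R H\<^sub>0\<^sup>n\<close>, saturated with respect to the relations. It turns out to
  be the whole left ideal generated by \<open>R\<close>.
\<close>

inductive hr_span :: "daha_gen free_algebra \<Rightarrow> bool" where
  base: "x \<in> {1, Z, Y, Z * Y} \<Longrightarrow> hr_span (x * R)"
| add: "hr_span v \<Longrightarrow> hr_span w \<Longrightarrow> hr_span (v + w)"
| scale: "hr_span w \<Longrightarrow> hr_span (k *\<^sub>C w)"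
| left: "hr_span w \<Longrightarrow> hr_span (H1 * w)"
| right: "hr_span w \<Longrightarrow> hr_span (w * H0)"
| congr: "hr_span v \<Longrightarrow> v \<approx> w \<Longrightarrow> hr_span w"

lemma hr_span_diff: "hr_span v \<Longrightarrow> hr_span w \<Longrightarrow> hr_span (v - w)"
  using hr_span.add [of v "- w"] hr_span.scale [of w "-1"] by simp

lemma hr_span_sym: "w \<approx> v \<Longrightarrow> hr_span v \<Longrightarrow> hr_span w"
  by (blast intro: hr_span.congr eq_mod_sym)

lemma hr_span_R: "hr_span R"
  and hr_span_Z_R: "hr_span (Z * R)"
  and hr_span_Y_R: "hr_span (Y * R)"
  and hr_span_Z_Y_R: "hr_span (Z * (Y * R))"
  using hr_span.base [of 1] hr_span.base [of Z] hr_span.base [of Y] hr_span.base [of "Z * Y"]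
  by (simp_all add: mult.assoc)

lemma Z_H1: "Z * H1 \<approx> H1 * Z"
  by (rule eq_mod_rebalance [OF eq_mod_diff [OF Z_Zi Zi_Z]]) (simp add: algebra_simps)

lemma R_H0: "R * H0 \<approx> H0 * R" and R_H1: "R * H1 \<approx> H1 * R"
  by (intro R_commute T_H0 T_H1)+

text \<open>\<open>Z\<close> commutes with \<open>H1\<close> and does not meet the right factor
  \<open>H0\<close>, so the base elements decide. There \<open>Z * Z\<close> is reduced by the
  quadratic equation \<open>Z^2 = H1 * Z - 1\<close>.\<close>

lemma hr_span_Z: "hr_span w \<Longrightarrow> hr_span (Z * w)"
proof (induction rule: hr_span.induct)
  case (base x)
  have Z_Z: "hr_span (Z * (Z * w))" if "hr_span w" "hr_span (Z * w)" for w
  proof (rule hr_span_sym)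
    show "Z * (Z * w) \<approx> H1 * (Z * w) - w"
      by (rule eq_mod_rebalance [OF eq_mod_mult [OF eq_mod_sym [OF Zi_Z] eq_mod_refl [of _ w]]])
        (simp add: algebra_simps)
  qed (intro hr_span_diff hr_span.left that)
  show ?case
    using base
    by (auto simp: mult.assoc intro: Z_Z [OF hr_span_R hr_span_Z_R]
      Z_Z [OF hr_span_Y_R hr_span_Z_Y_R] hr_span_Z_R hr_span_Z_Y_R)
next
  case (left w)
  have "Z * (H1 * w) \<approx> H1 * (Z * w)"
    using eq_mod_mult [OF Z_H1 eq_mod_refl [of _ w]] by (simp only: mult.assoc)
  then show ?case
    by (rule hr_span_sym) (intro hr_span.left left.IH)
next
  case (right w)
  then show ?case
    using hr_span.right [of "Z * w"] by (simp only: mult.assoc)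
next
  case (congr v w)
  then show ?case
    by (blast intro: hr_span.congr eq_mod_mult eq_mod_refl)
qed (simp_all add: distrib_left hr_span.add hr_span.scale)

lemma hr_span_Zi: "hr_span w \<Longrightarrow> hr_span (Zi * w)"
proof -
  assume "hr_span w"
  then have "hr_span (H1 * w - Z * w)"
    by (intro hr_span_diff hr_span.left hr_span_Z)
  then show ?thesis by (simp add: distrib_right)
qed

text \<open>The span contains \<open>R * H0\<close>, which equals \<open>H0 * R\<close> since
  \<open>H0\<close> commutes with \<open>T\<close>. Subtracting \<open>Y * R\<close> leaves a
  nonzero multiple of \<open>Yi * R\<close>.\<close>

lemma hr_span_Yi_R: "hr_span (Yi * R)"
proof -
  have "hr_span (R * H0 - Y * R)"
    by (intro hr_span_diff hr_span.right hr_span_R hr_span_Y_R)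
  then have "hr_span (H0 * R - Y * R)"
    by (rule hr_span.congr) (intro eq_mod_diff R_H0 eq_mod_refl)
  then have "hr_span ((1/q * (a*b*c*d)) *\<^sub>C (Yi * R))"
    by (simp add: free_algebra_simps)
  then have "hr_span ((q / (a*b*c*d)) *\<^sub>C (1/q * (a*b*c*d)) *\<^sub>C (Yi * R))"
    by (rule hr_span.scale)
  then show ?thesis
    using nz q_nz by simp
qed

lemmas hr_span_intros = hr_span.add hr_span.scale hr_span_diff hr_span_Z hr_span_Zi hr_span_R hr_span_Y_R hr_span_Yi_R

text \<open>On the base elements \<open>T\<close> acts by the formulas for \<open>T * x * R\<close>,
  and it commutes with the left factor \<open>H1\<close>.\<close>

lemma hr_span_T: "hr_span w \<Longrightarrow> hr_span (T * w)"
proof (induction rule: hr_span.induct)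
  case (base x)
  then consider "x = 1" | "x = Z" | "x = Y" | "x = Z * Y" by blast
  then show ?case
  proof cases
    case 1
    have "hr_span (T * R)"
      by (rule hr_span_sym [OF T_R]) (intro hr_span_intros)
    then show ?thesis using 1 by simp
  next
    case 2
    have "hr_span (T * Z * R)"
      by (rule hr_span_sym [OF T_Z_R]) (simp only: left_diff_distrib scale_mult_left mult_1_left, intro hr_span_intros)
    then show ?thesis using 2 by (simp only: mult.assoc)
  next
    case 3
    have "hr_span (T * Y * R)"
      by (rule hr_span_sym [OF T_Y_R]) (simp only: left_diff_distrib scale_mult_left mult_1_left, intro hr_span_intros)
    then show ?thesis using 3 by (simp only: mult.assoc)
  next
    case 4
    have "hr_span (T * Z * Y * R)"
      by (rule hr_span_sym [OF T_Z_Y_R])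
        (simp only: left_diff_distrib scale_mult_left mult_1_left mult.assoc, intro hr_span_intros)
    then show ?thesis using 4 by (simp only: mult.assoc)
  qed
next
  case (left w)
  have "T * (H1 * w) \<approx> H1 * (T * w)"
    using eq_mod_mult [OF T_H1 eq_mod_refl [of _ w]] by (simp only: mult.assoc)
  then show ?case
    by (rule hr_span_sym) (intro hr_span.left left.IH)
next
  case (right w)
  then show ?case
    using hr_span.right [of "T * w"] by (simp only: mult.assoc)
next
  case (congr v w)
  then show ?case
    by (blast intro: hr_span.congr eq_mod_mult eq_mod_refl)
qed (simp_all add: distrib_left hr_span.add hr_span.scale)

text \<open>
  The relations move \<open>Y\<close> past \<open>Z\<close> only at the cost of terms in \<open>T\<^sub>1\<close> and \<open>Y\<^sup>-\<^sup>1\<close>. Stability under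
  \<open>Y\<close> therefore needs this stronger property as induction invariant.
\<close>

definition ystable where "ystable w \<longleftrightarrow> hr_span w \<and> hr_span (Y * w) \<and> hr_span (Yi * w)"

lemma ystable_T:
  assumes "ystable w"
  shows "ystable (T * w)"
proof -
  from assms have w: "hr_span w" "hr_span (Y * w)" "hr_span (Yi * w)" by (simp_all add: ystable_def)
  \<comment> \<open>These are the relations for \<open>T * Yi\<close> and \<open>T * Y\<close>,
    solved for \<open>Y * T\<close> and \<open>Yi * T\<close>.\<close>
  have 1: "Y * T \<approx> (1/q * (a*b*c*d)) *\<^sub>C (T * Yi) - (1 + a*b) *\<^sub>C Y + (a*b*s) *\<^sub>C 1"
    by (rule eq_mod_rebalance [OF eq_mod_scale [OF eq_mod_sym [OF T_Yi], of "1/q * (a*b*c*d)"]],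
        rule poly_mapping_eqI)
      (use nz q_nz in \<open>simp add: lookup_add lookup_minus free_algebra_simps field_simps\<close>)
  have 2: "Yi * T \<approx> (q / (a*b*c*d)) *\<^sub>C (T * Y + (a*b + 1) *\<^sub>C Y - (a*b*s) *\<^sub>C 1)"
    by (rule eq_mod_rebalance [OF eq_mod_scale [OF eq_mod_sym [OF T_Y], of "q / (a*b*c*d)"]],
        rule poly_mapping_eqI)
      (use nz q_nz in \<open>simp add: lookup_add lookup_minus free_algebra_simps field_simps\<close>)
  have "hr_span (Y * T * w)"
    by (rule hr_span_sym [OF eq_mod_mult [OF 1 eq_mod_refl]])
      (simp only: distrib_right left_diff_distrib scale_mult_left mult_1_left mult.assoc,
        intro hr_span_intros hr_span_T w)
  moreover have "hr_span (Yi * T * w)"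
    by (rule hr_span_sym [OF eq_mod_mult [OF 2 eq_mod_refl]])
      (simp only: distrib_right left_diff_distrib scale_mult_left mult_1_left mult.assoc,
        intro hr_span_intros hr_span_T w)
  ultimately show ?thesis
    using hr_span_T [OF w(1)] by (simp add: ystable_def mult.assoc)
qed

lemma ystable_Z:
  assumes "ystable w"
  shows "ystable (Z * w)" "ystable (Zi * w)"
proof -
  from assms have w: "hr_span w" "hr_span (Y * w)" "hr_span (Yi * w)" by (simp_all add: ystable_def)
  \<comment> \<open>Moving \<open>Y\<close> or \<open>Yi\<close> past \<open>Z\<close> or
    \<open>Zi\<close> creates terms with \<open>Yi * T\<close> in front of \<open>w\<close>;
    stability of \<open>T * w\<close> controls them.\<close>
  from ystable_T [OF assms] have Tw: "hr_span (T * w)" "hr_span (Yi * (T * w))" by (simp_all add: ystable_def)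
  have "hr_span (Y * Z * w)"
    by (rule hr_span_sym [OF eq_mod_mult [OF Y_Z eq_mod_refl]])
      (simp only: distrib_right left_diff_distrib scale_mult_left mult_1_left mult.assoc,
        intro hr_span_intros w Tw)
  moreover have "hr_span (Yi * Z * w)"
    by (rule hr_span_sym [OF eq_mod_mult [OF Yi_Z eq_mod_refl]])
      (simp only: distrib_right left_diff_distrib scale_mult_left mult_1_left mult.assoc,
        intro hr_span_intros w Tw)
  moreover have "hr_span (Y * Zi * w)"
    by (rule hr_span_sym [OF eq_mod_mult [OF Y_Zi eq_mod_refl]])
      (simp only: distrib_right left_diff_distrib scale_mult_left mult_1_left mult.assoc,
        intro hr_span_intros w Tw)
  moreover have "hr_span (Yi * Zi * w)"
    by (rule hr_span_sym [OF eq_mod_mult [OF Yi_Zi eq_mod_refl]])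
      (simp only: distrib_right left_diff_distrib scale_mult_left mult_1_left mult.assoc,
        intro hr_span_intros w Tw)
  ultimately show "ystable (Z * w)" "ystable (Zi * w)"
    using hr_span_Z [OF w(1)] hr_span_Zi [OF w(1)] by (simp_all add: ystable_def mult.assoc)
qed

lemma ystable_cong: "ystable v \<Longrightarrow> v \<approx> w \<Longrightarrow> ystable w"
  unfolding ystable_def by (blast intro: hr_span.congr eq_mod_mult eq_mod_refl)

lemma ystable_add: "ystable v \<Longrightarrow> ystable w \<Longrightarrow> ystable (v + w)"
  by (simp add: ystable_def distrib_left hr_span.add)

lemma ystable_R: "ystable R"
  by (simp only: ystable_def hr_span_R hr_span_Y_R hr_span_Yi_R)

text \<open>\<open>Y * Y\<close> is \<open>Y * H0\<close> minus a scalar, and \<open>H0\<close>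
  moves through \<open>R\<close> to the right end, where multiplication by it preserves the
  span.\<close>

lemma ystable_Y_R: "ystable (Y * R)"
proof -
  have "Y * (Y * R) \<approx> (Y * R) * H0 - (1/q * (a*b*c*d)) *\<^sub>C R"
    by (rule eq_mod_rebalance [OF eq_mod_diff [OF eq_mod_sym [OF eq_mod_mult [OF eq_mod_refl [of _ Y] R_H0]]
        eq_mod_scale [OF eq_mod_mult [OF Y_Yi eq_mod_refl [of _ R]], of "1/q * (a*b*c*d)"]]])
     (rule poly_mapping_eqI, simp add: lookup_add lookup_minus free_algebra_simps)
  then have "hr_span (Y * (Y * R))"
    by (rule hr_span_sym) (intro hr_span_intros hr_span.right)
  moreover have "Yi * (Y * R) \<approx> R"
    using eq_mod_mult [OF Yi_Y eq_mod_refl [of _ R]] by (simp only: mult.assoc mult_1_left)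
  then have "hr_span (Yi * (Y * R))"
    by (rule hr_span_sym) (rule hr_span_R)
  ultimately show ?thesis
    by (simp only: ystable_def hr_span_Y_R)
qed

text \<open>Stability spreads from \<open>R\<close> and \<open>Y * R\<close>: a left factor
  \<open>H1\<close> is \<open>Z + Zi\<close>, covered by \<open>ystable_Z\<close>, and a right
  factor \<open>H0\<close> does not interfere.\<close>

lemma hr_span_imp_ystable: "hr_span w \<Longrightarrow> ystable w"
proof (induction rule: hr_span.induct)
  case (base x)
  have "ystable (1 * R)" "ystable (Z * R)" "ystable (Y * R)" "ystable (Z * Y * R)"
    using ystable_R ystable_Z ystable_Y_R by (simp_all only: mult_1_left mult.assoc)
  then show ?case using base by blast
next
  case (left w)
  then show ?case
    using ystable_add [OF ystable_Z] by (simp only: distrib_right)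
next
  case (right w)
  then show ?case
    using hr_span.right [of w] hr_span.right [of "Y * w"] hr_span.right [of "Yi * w"]
    by (simp only: ystable_def mult.assoc)
next
  case (congr v w)
  then show ?case by (blast intro: ystable_cong)
qed (simp_all add: ystable_def distrib_left hr_span.add hr_span.scale)

text \<open>The span contains \<open>R\<close> and is stable under left multiplication by every
  generator, so it exhausts the left ideal.\<close>

lemma hr_span_mult_R: "hr_span (h * R)"
proof (induction h rule: free_algebra_induct)
  case one
  show ?case by (simp only: mult_1_left hr_span_R)
next
  case (gen g p)
  then show ?case
    using hr_span_imp_ystable [OF gen] hr_span_T hr_span_Z hr_span_Zi by (cases g) (simp_all add: mult.assoc ystable_def)
next
  case (scale k p)
  then show ?case by (simp only: scale_mult_left hr_span.scale)
next
  case (add p r)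
  then show ?case by (simp only: distrib_right hr_span.add)
qed

section \<open>Polynomials in \<open>H0\<close> and \<open>H1\<close>, and the products
  \<open>R x R\<close>\<close>

abbreviation awt_to_daha :: "awt_gen free_algebra \<Rightarrow> daha_gen free_algebra" where
  "awt_to_daha \<equiv> subst (\<lambda>g. case g of AWT_K0 \<Rightarrow> H0 | AWT_K1 \<Rightarrow> H1 | AWT_T1 \<Rightarrow> T)"

abbreviation aw_to_daha :: "aw_gen free_algebra \<Rightarrow> daha_gen free_algebra" where
  "aw_to_daha \<equiv> subst (\<lambda>g. case g of AW_K0 \<Rightarrow> H0 | AW_K1 \<Rightarrow> H1)"

lemma awt_to_daha_tilde: "awt_to_daha (tilde U) = aw_to_daha U"
  unfolding tilde_eq_subst subst_subst
  by (rule arg_cong [where f = "\<lambda>f. subst f U"], rule ext) (simp split: aw_gen.split)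

lemma aw_to_daha_commute_R: "aw_to_daha U * R \<approx> R * aw_to_daha U"
proof (induction U rule: free_algebra_induct)
  case (gen g p)
  let ?g = "aw_to_daha (gen g)"
  have "?g * (aw_to_daha p * R) \<approx> ?g * (R * aw_to_daha p)"
    by (intro eq_mod_mult eq_mod_refl gen)
  also have "?g * (R * aw_to_daha p) = (?g * R) * aw_to_daha p"
    by (simp only: mult.assoc)
  also have "\<dots> \<approx> (R * ?g) * aw_to_daha p"
    by (rule eq_mod_mult [OF eq_mod_sym eq_mod_refl])
      (cases g; simp only: subst_gen aw_gen.case R_H0 R_H1)
  finally show ?case by (simp only: subst_mult mult.assoc)
next
  case (add p r)
  then show ?case
    unfolding subst_add distrib_left [of R] distrib_right [of "aw_to_daha p"] by (rule eq_mod_add)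
next
  case (scale k p)
  then show ?case by (simp only: subst_scale scale_mult_left scale_mult_right eq_mod_scale)
qed simp

text \<open>\<open>R\<close> passes \<open>H1\<close>, and a right factor \<open>H0\<close> moves
  back through \<open>R\<close>; both are absorbed into \<open>U\<close>. Only the base elements
  require explicit polynomials.\<close>

lemma R_nspan: "hr_span w \<Longrightarrow> \<exists>U. R * w \<approx> aw_to_daha U * R"
proof (induction rule: hr_span.induct)
  case (base x)
  let ?K0 = "gen AW_K0" and ?K1 = "gen AW_K1"
  note simps = lookup_add lookup_minus free_algebra_simps
  have "R * R \<approx> aw_to_daha ((1 - a*b) *\<^sub>C 1) * R"
    by (rule eq_mod_rebalance [OF R_R]) simp
  \<comment> \<open>The polynomials for \<open>Z\<close> and \<open>Y\<close> come from
    \<open>R * x * R = x * R + T * x * R\<close>, where \<open>Z\<close> and \<open>Zi\<close>,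
    respectively \<open>Y\<close> and \<open>Yi\<close>, combine to a multiple of \<open>H1\<close>
    or \<open>H0\<close>.\<close>
  moreover have "R * (Z * R) \<approx> aw_to_daha (?K1 - (a + b) *\<^sub>C 1) * R"
    by (rule eq_mod_rebalance [OF T_Z_R], rule poly_mapping_eqI) (simp add: simps)
  moreover have "R * (Y * R) \<approx> aw_to_daha ((a*b*s) *\<^sub>C 1 - (a*b) *\<^sub>C ?K0) * R"
    by (rule eq_mod_rebalance [OF T_Y_R], rule poly_mapping_eqI) (simp add: simps)
  moreover have "\<exists>U. R * (Z * Y * R) \<approx> aw_to_daha U * R"
  proof
    let ?U = "q *\<^sub>C (?K0 * ?K1) - ?K1 * ?K0
      - ((1 - q) * ((a*b - 1) * (c + d) + q * (a + b) * s)) *\<^sub>C 1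
      - ((q^2 - 1) * (a + b)) *\<^sub>C ?K0"
    have "(1 / (q^2 - 1)) *\<^sub>C (q^2 - 1) *\<^sub>C (R * Z * Y * R) \<approx> (1 / (q^2 - 1)) *\<^sub>C (aw_to_daha ?U * R)"
      using eq_mod_scale [OF R_Z_Y_R, of "1 / (q^2 - 1)"] by simp
    then show "R * (Z * Y * R) \<approx> aw_to_daha ((1 / (q^2 - 1)) *\<^sub>C ?U) * R"
      using q2 by (simp add: mult.assoc)
  qed
  ultimately show ?case
    using base by (auto simp only: insert_iff empty_iff mult_1_left)
next
  case (add v w)
  then obtain U V where "R * v \<approx> aw_to_daha U * R" "R * w \<approx> aw_to_daha V * R" by blast
  then have "R * (v + w) \<approx> aw_to_daha (U + V) * R"
    unfolding distrib_left [of R v w] subst_add distrib_right [of "aw_to_daha U"] by (rule eq_mod_add)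
  then show ?case ..
next
  case (scale w k)
  then obtain U where "R * w \<approx> aw_to_daha U * R" by blast
  then have "R * (k *\<^sub>C w) \<approx> aw_to_daha (k *\<^sub>C U) * R"
    unfolding scale_mult_right subst_scale scale_mult_left by (rule eq_mod_scale)
  then show ?case ..
next
  case (left w)
  then obtain U where U: "R * w \<approx> aw_to_daha U * R" by blast
  have "R * H1 * w \<approx> H1 * R * w"
    by (intro eq_mod_mult R_H1 eq_mod_refl)
  also have "H1 * R * w = H1 * (R * w)"
    by (simp only: mult.assoc)
  also have "\<dots> \<approx> H1 * (aw_to_daha U * R)"
    by (intro eq_mod_mult U eq_mod_refl)
  also have "\<dots> = aw_to_daha (gen AW_K1 * U) * R"
    by (simp add: mult.assoc)
  finally show ?case by (auto simp only: mult.assoc)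
next
  case (right w)
  then obtain U where U: "R * w \<approx> aw_to_daha U * R" by blast
  have "R * w * H0 \<approx> aw_to_daha U * R * H0"
    by (intro eq_mod_mult U eq_mod_refl)
  also have "\<dots> = aw_to_daha U * (R * H0)"
    by (simp only: mult.assoc)
  also have "\<dots> \<approx> aw_to_daha U * (H0 * R)"
    by (intro eq_mod_mult R_H0 eq_mod_refl)
  also have "\<dots> = aw_to_daha (U * gen AW_K0) * R"
    by (simp add: mult.assoc)
  finally show ?case by (auto simp only: mult.assoc)
next
  case (congr v w)
  then obtain U where "R * v \<approx> aw_to_daha U * R" by blast
  moreover have "R * w \<approx> R * v"
    by (intro eq_mod_mult eq_mod_refl eq_mod_sym [OF congr.hyps(2)])
  ultimately show ?case
    by (blast intro: eq_mod_trans)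
qed

lemma spherical_spanned: "\<exists>U. R * h * R \<approx> aw_to_daha U * R"
  using R_nspan [OF hr_span_mult_R] by (simp only: mult.assoc)

end


section \<open>The spherical subalgebra\<close>

text \<open>The known embedding of the extended algebra enters as an assumption, specified by its
  values on the generators.\<close>

locale daha_embedding = daha +
  fixes \<iota>
  assumes hom: "\<iota> \<in> alg_hom AWT DAHA"
    and inj: "inj_on \<iota> (carrier AWT)"
    and \<iota>_K0: "\<iota> (AWT_class (gen AWT_K0)) = DAHA_class H0"
    and \<iota>_K1: "\<iota> (AWT_class (gen AWT_K1)) = DAHA_class H1"
    and \<iota>_T1: "\<iota> (AWT_class (gen AWT_T1)) = DAHA_class T"
begin

lemmas class_simps = presented_algebra_simps [where R = AWT_relations, folded AWT_def AWT_class_def]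
  presented_algebra_simps [where R = DAHA_relations, folded DAHA_def DAHA_class_def]
  presented_algebra_simps [where R = AW_relations, folded AW_def AW_class_def]

lemmas class_eq_iff =
  presented_class_eq_iff [where R = AWT_relations, folded AWT_class_def]
  presented_class_eq_iff [where R = DAHA_relations, folded DAHA_class_def]
  presented_class_eq_iff [where R = AW_relations, folded AW_class_def]

text \<open>A homomorphism is determined by its values on generators, so \<iota> can be computed on
  representatives.\<close>

lemma \<iota>_class: "\<iota> (AWT_class p) = DAHA_class (awt_to_daha p)"
proof -
  have \<iota>: "\<iota> (AWT_class (p * r)) = \<iota> (AWT_class p) \<otimes>\<^bsub>DAHA\<^esub> \<iota> (AWT_class r)"
    "\<iota> (AWT_class (p + r)) = \<iota> (AWT_class p) \<oplus>\<^bsub>DAHA\<^esub> \<iota> (AWT_class r)"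
    "\<iota> (AWT_class (k *\<^sub>C p)) = k \<odot>\<^bsub>DAHA\<^esub> \<iota> (AWT_class p)"
    "\<iota> (AWT_class 1) = DAHA_class 1" for p r k
  proof -
    have carr: "AWT_class r \<in> carrier AWT" for r
      by (simp add: class_simps)
    have \<iota>: "\<iota> \<in> ring_hom AWT DAHA"
      "\<iota> (k \<odot>\<^bsub>AWT\<^esub> AWT_class p) = k \<odot>\<^bsub>DAHA\<^esub> \<iota> (AWT_class p)"
      using hom carr by (auto simp: alg_hom_def)
    show "\<iota> (AWT_class (p * r)) = \<iota> (AWT_class p) \<otimes>\<^bsub>DAHA\<^esub> \<iota> (AWT_class r)"
      using ring_hom_mult [OF \<iota>(1) carr carr] by (simp add: class_simps)
    show "\<iota> (AWT_class (p + r)) = \<iota> (AWT_class p) \<oplus>\<^bsub>DAHA\<^esub> \<iota> (AWT_class r)"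
      using ring_hom_add [OF \<iota>(1) carr carr] by (simp add: class_simps)
    show "\<iota> (AWT_class (k *\<^sub>C p)) = k \<odot>\<^bsub>DAHA\<^esub> \<iota> (AWT_class p)"
      using \<iota>(2) by (simp add: class_simps)
    show "\<iota> (AWT_class 1) = DAHA_class 1"
      using ring_hom_one [OF \<iota>(1)] by (simp add: class_simps)
  qed
  show ?thesis
  proof (induction p rule: free_algebra_induct)
    case (gen g p)
    have "\<iota> (AWT_class (gen g)) = DAHA_class (awt_to_daha (gen g))"
      by (cases g) (simp_all add: \<iota>_K0 \<iota>_K1 \<iota>_T1)
    then show ?case
      using gen by (simp only: \<iota> class_simps subst_mult)
  qed (simp_all add: \<iota> class_simps)
qed

section \<open>The relations of \<open>AW\<close> on multiples of \<open>R\<close>\<close>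

lemma W_R: "(T + (a*b) *\<^sub>C 1) * R \<approx> 0"
  by (rule eq_mod_rebalance [OF T_R]) (simp add: distrib_right)

lemma W_aw_to_daha_R: "(T + (a*b) *\<^sub>C 1) * (aw_to_daha U * R) \<approx> 0"
proof -
  have "(T + (a*b) *\<^sub>C 1) * (aw_to_daha U * R) \<approx> (T + (a*b) *\<^sub>C 1) * (R * aw_to_daha U)"
    by (rule eq_mod_mult [OF eq_mod_refl aw_to_daha_commute_R])
  also have "\<dots> = (T + (a*b) *\<^sub>C 1) * R * aw_to_daha U"
    by (simp only: mult.assoc)
  also have "\<dots> \<approx> 0 * aw_to_daha U"
    by (rule eq_mod_mult [OF W_R eq_mod_refl])
  finally show ?thesis by simp
qed

text \<open>The existence of \<iota> replaces a computation: congruent elements represent the same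
  class and so have the same image.\<close>

lemma awt_relations:
  assumes "(l, r) \<in> AWT_relations"
  shows "awt_to_daha l \<approx> awt_to_daha r"
  using eq_mod_rel [OF assms] by (metis \<iota>_class class_eq_iff(1,2))

text \<open>Right multiplication by \<open>R\<close> kills the extra terms in the relations of the
  extended algebra, since each contains the factor \<open>T + (a*b) *\<^sub>C 1\<close>.\<close>

lemma aw_relation_R:
  assumes "(l, r) \<in> AW_relations"
  shows "aw_to_daha l * R \<approx> aw_to_daha r * R"
proof -
  \<comment> \<open>Opaque names keep \<open>simp\<close> from expanding \<open>H0\<close> and
    \<open>H1\<close>.\<close>
  define K0 K1 W R' where defs: "K0 = H0" "K1 = H1" "W = T + (a*b) *\<^sub>C 1" "R' = R"
  note simps = lookup_add lookup_minus free_algebra_simps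
  have W: "W * R' \<approx> 0" "K0 * (W * R') \<approx> 0" "K1 * (W * R') \<approx> 0"
    using W_R eq_mod_mult [OF eq_mod_refl W_R, of H0] eq_mod_mult [OF eq_mod_refl W_R, of H1]
    by (simp_all only: defs mult_zero_right)
  \<comment> \<open>In the third relation \<open>W\<close> may stand to the left of a polynomial in
    \<open>K0\<close> and \<open>K1\<close>; it reaches \<open>R'\<close> because \<open>R'\<close>
    commutes with that polynomial.\<close>
  have W': "W * (K0 * R') \<approx> 0" "W * (K1 * R') \<approx> 0"
    "W * (((q + 1 + 1/q) *\<^sub>C (K0*K1) + K1*K0) * R') \<approx> 0"
    using W_aw_to_daha_R [of "gen AW_K0"] W_aw_to_daha_R [of "gen AW_K1"]
      W_aw_to_daha_R [of "(q + 1 + 1/q) *\<^sub>C (gen AW_K0*gen AW_K1) + gen AW_K1*gen AW_K0"]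
    by (simp_all only: defs subst_gen aw_gen.case subst_add subst_mult subst_scale)
  have rels: "\<forall>(l, r) \<in> AWT_relations. awt_to_daha l \<approx> awt_to_daha r"
    using awt_relations by blast
  have 1: "(q + 1/q) *\<^sub>C (K1*K0*K1) - K1^2*K0 - K0*K1^2 \<approx>
      B *\<^sub>C K1 + C0 *\<^sub>C K0 + D0 *\<^sub>C 1 + E *\<^sub>C (K1*W) + F0 *\<^sub>C W"
    and 2: "(q + 1/q) *\<^sub>C (K0*K1*K0) - K0^2*K1 - K1*K0^2 \<approx>
      B *\<^sub>C K0 + C1 *\<^sub>C K1 + D1 *\<^sub>C 1 + E *\<^sub>C (K0*W) + F1 *\<^sub>C W"
    and 3: "Q0 *\<^sub>C 1 \<approx>
        (K1*K0)^2 - (q^2 + 1 + 1/q^2) *\<^sub>C (K0*(K1*K0)*K1) + (q + 1/q) *\<^sub>C (K0^2*K1^2)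
          + (q + 1/q) *\<^sub>C (C0 *\<^sub>C K0^2 + C1 *\<^sub>C K1^2)
          + (B *\<^sub>C 1 + E *\<^sub>C W) * ((q + 1 + 1/q) *\<^sub>C (K0*K1) + K1*K0)
          + (q + 1 + 1/q) *\<^sub>C ((D0 *\<^sub>C 1 + F0 *\<^sub>C W) * K0)
          + (q + 1 + 1/q) *\<^sub>C ((D1 *\<^sub>C 1 + F1 *\<^sub>C W) * K1)
          + G *\<^sub>C W"
    using rels
    by (simp_all only: AWT_relations_def Let_def ball_simps case_prod_conv defs
      subst_add subst_diff subst_mult subst_scale subst_power subst_gen subst_1 awt_gen.case)
  have "((q + 1/q) *\<^sub>C (K1*K0*K1) - K1^2*K0 - K0*K1^2) * R' \<approx>
      (B *\<^sub>C K1 + C0 *\<^sub>C K0 + D0 *\<^sub>C 1) * R'"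
    by (rule eq_mod_rebalance [OF eq_mod_add [OF eq_mod_mult [OF 1 eq_mod_refl [of _ R']]
        eq_mod_add [OF eq_mod_scale [OF W(3), of E] eq_mod_scale [OF W(1), of F0]]]])
     (simp add: free_algebra_simps)
  moreover have "((q + 1/q) *\<^sub>C (K0*K1*K0) - K0^2*K1 - K1*K0^2) * R' \<approx>
      (B *\<^sub>C K0 + C1 *\<^sub>C K1 + D1 *\<^sub>C 1) * R'"
    by (rule eq_mod_rebalance [OF eq_mod_add [OF eq_mod_mult [OF 2 eq_mod_refl [of _ R']]
        eq_mod_add [OF eq_mod_scale [OF W(2), of E] eq_mod_scale [OF W(1), of F1]]]])
     (simp add: free_algebra_simps)
  moreover have "(K1*K0*K1*K0 - (q^2 + 1 + 1/q^2) *\<^sub>C (K0*K1*K0*K1) + (q + 1/q) *\<^sub>C (K0^2*K1^2)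
          + (q + 1/q) *\<^sub>C (C0 *\<^sub>C K0^2 + C1 *\<^sub>C K1^2)
          + B *\<^sub>C ((q + 1 + 1/q) *\<^sub>C (K0*K1) + K1*K0)
          + (q + 1 + 1/q) *\<^sub>C (D0 *\<^sub>C K0 + D1 *\<^sub>C K1)) * R' \<approx> (Q0 *\<^sub>C 1) * R'"
    by (rule eq_mod_rebalance [OF eq_mod_add [OF eq_mod_mult [OF eq_mod_sym [OF 3] eq_mod_refl [of _ R']]
        eq_mod_diff [OF eq_mod_refl [of _ 0] eq_mod_add [OF eq_mod_add [OF eq_mod_scale [OF W'(3), of E] eq_mod_scale [OF W(1), of G]]
          eq_mod_scale [OF eq_mod_add [OF eq_mod_scale [OF W'(1), of F0] eq_mod_scale [OF W'(2), of F1]], of "q + 1 + 1/q"]]]]],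
       rule poly_mapping_eqI)
     (simp add: simps)
  ultimately have "\<forall>(l, r) \<in> AW_relations. aw_to_daha l * R \<approx> aw_to_daha r * R"
    by (simp only: AW_relations_def Let_def ball_simps case_prod_conv defs
      subst_add subst_diff subst_mult subst_scale subst_power subst_gen subst_1 aw_gen.case)
  then show ?thesis
    using assms by blast
qed

text \<open>The relations are available after multiplication by \<open>R\<close>, so the kernel is
  replaced by the set of \<open>U\<close> whose image annihilates \<open>R\<close>. It is closed
  under right multiplication because \<open>R\<close> commutes with images of polynomials.\<close>

lemma aw_to_daha_R_cong:
  assumes "eq_mod AW_relations U V"
  shows "aw_to_daha U * R \<approx> aw_to_daha V * R"
proof -
  let ?J = "{U. aw_to_daha U * R \<approx> 0}"
  have "relation_ideal AW_relations \<subseteq> ?J"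
  proof (rule relation_ideal_minimal)
    show "l - r \<in> ?J" if "(l, r) \<in> AW_relations" for l r
      using eq_mod_rebalance [OF aw_relation_R [OF that], of "aw_to_daha (l - r) * R" 0]
      by (simp add: left_diff_distrib)
    show "x + y \<in> ?J" if "x \<in> ?J" "y \<in> ?J" for x y
      using eq_mod_add [OF that [THEN CollectD]]
      by (simp only: mem_Collect_eq subst_add distrib_right add_0_left)
    show "p * x \<in> ?J" if "x \<in> ?J" for x p
      using eq_mod_mult [OF eq_mod_refl that [THEN CollectD], of "aw_to_daha p"]
      by (simp only: mem_Collect_eq subst_mult mult.assoc mult_zero_right)
    show "x * p \<in> ?J" if "x \<in> ?J" for x p
    proof -
      have "aw_to_daha x * (aw_to_daha p * R) \<approx> aw_to_daha x * (R * aw_to_daha p)"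
        by (rule eq_mod_mult [OF eq_mod_refl aw_to_daha_commute_R])
      also have "\<dots> = aw_to_daha x * R * aw_to_daha p"
        by (simp only: mult.assoc)
      also have "\<dots> \<approx> 0 * aw_to_daha p"
        by (rule eq_mod_mult [OF that [THEN CollectD] eq_mod_refl])
      finally show ?thesis by (simp only: mem_Collect_eq subst_mult mult.assoc mult_zero_left)
    qed
  qed simp
  then have "aw_to_daha (U - V) * R \<approx> 0"
    using assms by (auto simp only: eq_mod_def)
  then show ?thesis
    by (rule eq_mod_rebalance) (simp add: left_diff_distrib)
qed

lemma aw_to_daha_R_eq_iff:
  "aw_to_daha U * R \<approx> aw_to_daha V * R \<longleftrightarrow> eq_mod AW_relations U V"
proof
  let ?R = "gen AWT_T1 + 1"
  assume "aw_to_daha U * R \<approx> aw_to_daha V * R"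
  \<comment> \<open>Both sides lie in the image of \<iota>, so injectivity carries the congruence
    back to the extended algebra.\<close>
  then have "\<iota> (AWT_class (tilde U * ?R)) = \<iota> (AWT_class (tilde V * ?R))"
    by (simp only: \<iota>_class class_eq_iff subst_mult subst_add subst_gen subst_1 awt_to_daha_tilde awt_gen.case)
  then have *: "eq_mod AWT_relations (tilde U * ?R) (tilde V * ?R)"
    by (subst (asm) inj_on_eq_iff [OF inj]) (simp_all only: class_simps class_eq_iff rangeI)
  \<comment> \<open>The specialization \<open>T1 = - a b\<close>, a left inverse of
    \<open>tilde\<close>.\<close>
  let ?f = "\<lambda>g. case g of AWT_K0 \<Rightarrow> gen AW_K0 | AWT_K1 \<Rightarrow> gen AW_K1 | AWT_T1 \<Rightarrow> - (a*b) *\<^sub>C 1"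
  have tilde: "subst ?f (tilde W) = W" for W
  proof -
    have "subst ?f (gen (awt_of_aw g)) = gen g" for g
      by (cases g) simp_all
    then show ?thesis by (simp only: tilde_eq_subst subst_subst subst_gens)
  qed
  have rel: "eq_mod AW_relations (subst ?f l) (subst ?f r)" if "(l, r) \<in> AWT_relations" for l r
  proof -
    let ?K0 = "gen AW_K0" and ?K1 = "gen AW_K1"
    have "eq_mod AW_relations ((q + 1/q) *\<^sub>C (?K1*?K0*?K1) - ?K1^2*?K0 - ?K0*?K1^2)
          (B *\<^sub>C ?K1 + C0 *\<^sub>C ?K0 + D0 *\<^sub>C 1)"
      and "eq_mod AW_relations ((q + 1/q) *\<^sub>C (?K0*?K1*?K0) - ?K0^2*?K1 - ?K1*?K0^2)
          (B *\<^sub>C ?K0 + C1 *\<^sub>C ?K1 + D1 *\<^sub>C 1)"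
      and "eq_mod AW_relations (?K1*?K0*?K1*?K0 - (q^2 + 1 + 1/q^2) *\<^sub>C (?K0*?K1*?K0*?K1) + (q + 1/q) *\<^sub>C (?K0^2*?K1^2)
          + (q + 1/q) *\<^sub>C (C0 *\<^sub>C ?K0^2 + C1 *\<^sub>C ?K1^2)
          + B *\<^sub>C ((q + 1 + 1/q) *\<^sub>C (?K0*?K1) + ?K1*?K0)
          + (q + 1 + 1/q) *\<^sub>C (D0 *\<^sub>C ?K0 + D1 *\<^sub>C ?K1))
        (Q0 *\<^sub>C 1)"
      by (rule eq_mod_rel, simp only: AW_relations_def Let_def insert_iff simp_thms)+
    \<comment> \<open>The third relation is turned around and brought to the form that its
      counterpart takes under \<open>?f\<close>.\<close>
    note AW = this(1,2) eq_mod_sym [OF this(3),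
      unfolded scale_add [of _ "D0 *\<^sub>C ?K0"] add.assoc [symmetric]]
    \<comment> \<open>The factor \<open>T\<^sub>1 + a b\<close> of all extra terms is sent to 0.\<close>
    have W: "- (a*b) *\<^sub>C 1 + (a*b) *\<^sub>C 1 = (0 :: aw_gen free_algebra)"
      by simp
    have "\<forall>(l, r) \<in> AWT_relations. eq_mod AW_relations (subst ?f l) (subst ?f r)"
      using AW
      by (simp only: AWT_relations_def Let_def ball_simps case_prod_conv
        subst_0 subst_add subst_diff subst_mult subst_scale subst_power subst_gen subst_1 awt_gen.case
        W mult_zero_left mult_zero_right scale_zero_right add_0_right scale_mult_left scale_mult_right
        mult_1_left mult_1_right mult.assoc power2_eq_square eq_mod_refl simp_thms)
    then show ?thesis
      using that by blast
  qed
  have "eq_mod AW_relations (subst ?f (tilde U * ?R)) (subst ?f (tilde V * ?R))"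
    by (rule subst_eq_mod [OF rel *])
  \<comment> \<open>Under the specialization \<open>T1 + 1\<close> becomes the nonzero scalar
    \<open>1 - a*b\<close>, which is then divided off.\<close>
  then have "eq_mod AW_relations ((1 - a*b) *\<^sub>C U) ((1 - a*b) *\<^sub>C V)"
    by (rule eq_mod_rebalance, intro poly_mapping_eqI) (simp add: tilde lookup_add lookup_minus free_algebra_simps)
  from eq_mod_scale [OF this, of "1 / (1 - a*b)"] show "eq_mod AW_relations U V"
    using ab by simp
qed (rule aw_to_daha_R_cong)

section \<open>The image of the symmetrizing map\<close>

abbreviation "\<kappa> \<equiv> 1 / (1 - a*b)"

lemma P_sym_eq: "P_sym = DAHA_class (\<kappa> *\<^sub>C R)"
  by (simp add: P_sym_def class_simps)

lemma S_class: "S (DAHA_class h) = DAHA_class ((\<kappa> * \<kappa>) *\<^sub>C (R * h * R))"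
  unfolding S_def P_sym_eq class_simps scale_mult_left scale_mult_right scale_scale ..

lemma R_aw_to_daha_R: "R * aw_to_daha U * R \<approx> (1 - a*b) *\<^sub>C (aw_to_daha U * R)"
proof -
  have "R * aw_to_daha U * R \<approx> aw_to_daha U * R * R"
    by (rule eq_mod_mult [OF eq_mod_sym [OF aw_to_daha_commute_R] eq_mod_refl])
  also have "\<dots> = aw_to_daha U * (R * R)"
    by (simp only: mult.assoc)
  also have "\<dots> \<approx> aw_to_daha U * ((1 - a*b) *\<^sub>C R)"
    by (rule eq_mod_mult [OF eq_mod_refl R_R])
  finally show ?thesis by (simp only: scale_mult_right)
qed

lemma S_aw_to_daha: "S (DAHA_class (aw_to_daha U)) = DAHA_class (\<kappa> *\<^sub>C (aw_to_daha U * R))"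
  using eq_mod_scale [OF R_aw_to_daha_R, of "\<kappa> * \<kappa>" U] ab
  by (simp add: S_class class_eq_iff)

lemma S_in_image: "\<exists>U. S (DAHA_class h) = DAHA_class (\<kappa> *\<^sub>C (aw_to_daha U * R))"
proof -
  obtain U where "R * h * R \<approx> aw_to_daha U * R"
    using spherical_spanned by blast
  then have "(\<kappa> * \<kappa>) *\<^sub>C (R * h * R) \<approx> (\<kappa> * \<kappa>) *\<^sub>C (aw_to_daha U * R)"
    by (rule eq_mod_scale)
  \<comment> \<open>One of the two factors \<kappa> is absorbed into \<open>U\<close>.\<close>
  then have "S (DAHA_class h) = DAHA_class (\<kappa> *\<^sub>C (aw_to_daha (\<kappa> *\<^sub>C U) * R))"
    by (simp only: S_class class_eq_iff subst_scale scale_mult_left scale_scale)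
  then show ?thesis ..
qed

lemma carrier_spherical: "S ` carrier DAHA = range (\<lambda>U. DAHA_class (\<kappa> *\<^sub>C (aw_to_daha U * R)))"
  unfolding class_simps using S_in_image S_aw_to_daha by (auto simp: image_iff) metis+

lemma S_image_AWT: "S ` \<iota> ` carrier AWT = S ` carrier DAHA"
proof
  show "S ` \<iota> ` carrier AWT \<subseteq> S ` carrier DAHA"
    by (auto simp: class_simps \<iota>_class)
  show "S ` carrier DAHA \<subseteq> S ` \<iota> ` carrier AWT"
  proof
    fix X assume "X \<in> S ` carrier DAHA"
    then obtain U where "X = DAHA_class (\<kappa> *\<^sub>C (aw_to_daha U * R))"
      by (auto simp only: carrier_spherical)
    then have X: "X = S (\<iota> (AWT_class (tilde U)))"
      by (simp only: \<iota>_class awt_to_daha_tilde S_aw_to_daha)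
    show "X \<in> S ` \<iota> ` carrier AWT"
      unfolding X class_simps by (intro imageI rangeI)
  qed
qed

section \<open>The isomorphism onto the spherical subalgebra\<close>

definition \<phi> where "\<phi> X = DAHA_class (\<kappa> *\<^sub>C (aw_to_daha (SOME U. AW_class U = X) * R))"

text \<open>From right to left this makes the choice of representative in \<phi> immaterial; from
  left to right it gives injectivity.\<close>

lemma scaled_eq_iff:
  "DAHA_class (\<kappa> *\<^sub>C (aw_to_daha U * R)) = DAHA_class (\<kappa> *\<^sub>C (aw_to_daha V * R)) \<longleftrightarrow> AW_class U = AW_class V"
proof -
  have "\<kappa> *\<^sub>C (aw_to_daha U * R) \<approx> \<kappa> *\<^sub>C (aw_to_daha V * R) \<longleftrightarrow> aw_to_daha U * R \<approx> aw_to_daha V * R"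
    using eq_mod_scale [of _ "\<kappa> *\<^sub>C (aw_to_daha U * R)" "\<kappa> *\<^sub>C (aw_to_daha V * R)" "1 - a*b"] ab
    by (auto intro: eq_mod_scale)
  then show ?thesis
    by (simp only: class_eq_iff aw_to_daha_R_eq_iff)
qed

lemma \<phi>_class: "\<phi> (AW_class U) = DAHA_class (\<kappa> *\<^sub>C (aw_to_daha U * R))"
  unfolding \<phi>_def scaled_eq_iff by (rule someI) (rule refl)

lemma spherical_simps:
  "carrier spherical = range (\<lambda>U. DAHA_class (\<kappa> *\<^sub>C (aw_to_daha U * R)))"
  "mult spherical = mult DAHA" "add spherical = add DAHA" "smult spherical = smult DAHA"
  "one spherical = P_sym"
  unfolding carrier_spherical [symmetric] by (simp_all add: spherical_def)

lemma \<phi>_iso: "\<phi> \<in> alg_iso AW spherical"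
proof -
  have "\<phi> \<in> ring_hom AW spherical"
  proof (rule ring_hom_memI)
    fix X V
    assume "X \<in> carrier AW" "V \<in> carrier AW"
    then obtain U U' where X: "X = AW_class U" "V = AW_class U'"
      by (auto simp: class_simps)
    \<comment> \<open>In the product of two images an additional \<open>R\<close> stands in the
      middle. Absorbing it costs the factor \<open>1 - a*b\<close>, which cancels one
      \<kappa>.\<close>
    have "R * aw_to_daha U' * R \<approx> (1 - a*b) *\<^sub>C (aw_to_daha U' * R)"
      by (rule R_aw_to_daha_R)
    then have "(\<kappa> * \<kappa>) *\<^sub>C (aw_to_daha U * (R * aw_to_daha U' * R))
        \<approx> (\<kappa> * \<kappa>) *\<^sub>C (aw_to_daha U * ((1 - a*b) *\<^sub>C (aw_to_daha U' * R)))"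
      by (intro eq_mod_scale eq_mod_mult [OF eq_mod_refl])
    then have *: "(\<kappa> *\<^sub>C (aw_to_daha U * R)) * (\<kappa> *\<^sub>C (aw_to_daha U' * R)) \<approx> \<kappa> *\<^sub>C (aw_to_daha (U * U') * R)"
      using ab by (simp add: mult.assoc)
    show "\<phi> (X \<otimes>\<^bsub>AW\<^esub> V) = \<phi> X \<otimes>\<^bsub>spherical\<^esub> \<phi> V"
      using eq_mod_sym [OF *] by (simp only: X class_simps \<phi>_class spherical_simps class_eq_iff)
    show "\<phi> (X \<oplus>\<^bsub>AW\<^esub> V) = \<phi> X \<oplus>\<^bsub>spherical\<^esub> \<phi> V"
      by (simp only: X class_simps \<phi>_class spherical_simps subst_add
        distrib_right [of "aw_to_daha U"] scale_add)
  next
    fix X assume "X \<in> carrier AW"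
    then show "\<phi> X \<in> carrier spherical"
      by (auto simp only: class_simps \<phi>_class spherical_simps)
  next
    show "\<phi> \<one>\<^bsub>AW\<^esub> = \<one>\<^bsub>spherical\<^esub>"
      by (simp only: class_simps \<phi>_class spherical_simps P_sym_eq subst_1 mult_1_left)
  qed
  moreover have "\<phi> (k \<odot>\<^bsub>AW\<^esub> X) = k \<odot>\<^bsub>spherical\<^esub> \<phi> X" if "X \<in> carrier AW" for k X
    using that
    by (auto simp only: class_simps \<phi>_class spherical_simps subst_scale scale_mult_left
      scale_scale mult.commute [of k])
  moreover have "bij_betw \<phi> (carrier AW) (carrier spherical)"
  proof (rule bij_betw_imageI)
    show "inj_on \<phi> (carrier AW)"
      by (rule inj_onI) (auto simp only: class_simps \<phi>_class scaled_eq_iff)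
    show "\<phi> ` carrier AW = carrier spherical"
      by (simp only: spherical_simps class_simps image_image \<phi>_class)
  qed
  ultimately show ?thesis
    by (simp add: alg_iso_def alg_hom_def)
qed

end

theorem theorem3p2:
  fixes q a b c d :: complex
    and \<iota> :: "awt_gen free_algebra set \<Rightarrow> daha_gen free_algebra set"
  assumes "q \<noteq> 0" and "\<forall>m::nat. m \<ge> 1 \<longrightarrow> q ^ m \<noteq> 1"
    and "a \<noteq> 0" "b \<noteq> 0" "c \<noteq> 0" "d \<noteq> 0"
    and "\<forall>m::nat. a*b*c*d \<noteq> 1 / q ^ m"
    and "a*b \<noteq> 1"
    and "\<iota> \<in> alg_hom (askey_wilson.AWT q a b c d) (askey_wilson.DAHA q a b c d)"
    and "inj_on \<iota> (carrier (askey_wilson.AWT q a b c d))"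
    and "\<iota> (askey_wilson.AWT_class q a b c d (gen AWT_K0)) =
           askey_wilson.DAHA_class q a b c d (gen H_Y + (1/q * (a*b*c*d)) *\<^sub>C gen H_Yinv)"
    and "\<iota> (askey_wilson.AWT_class q a b c d (gen AWT_K1)) =
           askey_wilson.DAHA_class q a b c d (gen H_Z + gen H_Zinv)"
    and "\<iota> (askey_wilson.AWT_class q a b c d (gen AWT_T1)) =
           askey_wilson.DAHA_class q a b c d (gen H_T1)"
  shows "askey_wilson.S q a b c d ` carrier (askey_wilson.DAHA q a b c d) =
           askey_wilson.S q a b c d ` \<iota> ` carrier (askey_wilson.AWT q a b c d)
       \<and> (\<exists>\<phi> \<in> alg_iso (askey_wilson.AW q a b c d) (askey_wilson.spherical q a b c d).
            \<forall>U. \<phi> (askey_wilson.AW_class q a b c d U) =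
              (1 / (1 - a*b)) \<odot>\<^bsub>askey_wilson.DAHA q a b c d\<^esub>
                (\<iota> (askey_wilson.AWT_class q a b c d (tilde U))
                 \<otimes>\<^bsub>askey_wilson.DAHA q a b c d\<^esub>
                 askey_wilson.DAHA_class q a b c d (gen H_T1 + 1)))"
proof -
  \<comment> \<open>The condition \<open>q^2 \<noteq> 1\<close> is the case \<open>m = 2\<close> of
    the assumption on the powers of \<open>q\<close>.\<close>
  interpret daha_embedding q a b c d \<iota>
    using assms by unfold_locales auto
  have "\<phi> (AW_class U) = (1 / (1 - a*b)) \<odot>\<^bsub>DAHA\<^esub>
      (\<iota> (AWT_class (tilde U)) \<otimes>\<^bsub>DAHA\<^esub> DAHA_class (gen H_T1 + 1))" for U
    by (simp only: \<phi>_class \<iota>_class awt_to_daha_tilde class_simps)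
  then show ?thesis
    by (intro conjI bexI [OF _ \<phi>_iso] allI S_image_AWT [symmetric])
qed

end
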